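(* Let $\Gamma$ be a finite, compact, connected, equilateral metric graph with $E$ edges. Then the inequality $$\lambda_{n+1}\big(L^{\rm st}(\Gamma)\big)\le\lambda_n\big(L^{\rm D}(\Gamma)\big)$$ holds for all $n\in\mathbb N$ if and only if $\Gamma$ is bipartite. Moreover, if $\Gamma$ is not bipartite, then this inequality fails exactly for $n=(2m+1)E$, $m=0,1,2,\dots$, and holds for all other $n\in\mathbb N$.
   Context: A finite compact metric graph $\Gamma$ consists of finitely many edges $e_n=[x_{2n-1},x_{2n}]\subset\mathbb R$, $n=1,\dots,E$, of positive lengths and a vertex set $\mathcal V$ which is a partition of the set of all edge endpoints (loops and multiple edges allowed). It is equilateral if all edges have the same length. $\Gamma$ is bipartite if $\mathcal V=\mathcal V_1\sqcup\mathcal V_2$ with every edge having one endpoint in a vertex of $\mathcal V_1$ and the other in a vertex of $\mathcal V_2$. $f(x_j)$ denotes the limit of $f$ at endpoint $x_j$, and $\partial f(x_j)=f'(x_j)$ if $x_j$ is a left endpoint, $-f'(x_j)$ if a right endpoint. The standard Laplacian $L^{\rm st}(\Gamma)$ acts as $-f''$ on each edge with domain all $f\in W^2_2(\Gamma\setminus\mathcal V)=\bigoplus_nW^2_2(e_n)$ with, at every vertex $v$, $f(x_i)=f(x_j)$ for $x_i,x_j\in v$ and $\sum_{x_j\in v}\partial f(x_j)=0$. The Dirichlet Laplacian $L^{\rm D}(\Gamma)$ acts as $-f''$ with domain all $f\in W^2_2(\Gamma\setminus\mathcal V)$ with $f(x_j)=0$ at every endpoint $x_j$. Eigenvalues $\lambda_1\le\lambda_2\le\dots$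 are counted with multiplicities. *)

theory Defs
  imports "HOL-Analysis.Analysis" "HOL-Library.Function_Algebras" "HOL-Library.Disjoint_Sets"
begin

(* A finite compact metric graph with E edges: edge i (i < E) is the interval [0, L i].
   Endpoints are pairs (i, False) = left endpoint 0 of edge i, (i, True) = right endpoint L i.
   The vertex set V is a partition of the set of all endpoints. *)

type_synonym endpoint = "nat \<times> bool"

definition endpoints :: "nat \<Rightarrow> endpoint set" where
  "endpoints E = {p. fst p < E}"

definition metric_graph :: "nat \<Rightarrow> (nat \<Rightarrow> real) \<Rightarrow> endpoint set set \<Rightarrow> bool" where
  "metric_graph E L V \<longleftrightarrow> (\<forall>i<E. L i > 0) \<and> partition_on (endpoints E) V"

definition equilateral :: "nat \<Rightarrow> (nat \<Rightarrow> real) \<Rightarrow> bool" where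
  "equilateral E L \<longleftrightarrow> (\<forall>i<E. \<forall>j<E. L i = L j)"

(* connectedness: any two endpoints are joined by a chain of steps, each step either
   staying in a vertex or running along an edge *)
definition graph_connected :: "nat \<Rightarrow> endpoint set set \<Rightarrow> bool" where
  "graph_connected E V \<longleftrightarrow>
     (\<forall>p\<in>endpoints E. \<forall>q\<in>endpoints E.
        (p, q) \<in> {(a, b). (\<exists>v\<in>V. a \<in> v \<and> b \<in> v) \<or> fst a = fst b}\<^sup>*)"

definition bipartite :: "nat \<Rightarrow> endpoint set set \<Rightarrow> bool" where
  "bipartite E V \<longleftrightarrow>
     (\<exists>V1 V2. V1 \<union> V2 = V \<and> V1 \<inter> V2 = {} \<and>
        (\<forall>i<E. \<forall>v\<in>V. \<forall>w\<in>V. (i, False) \<in> v \<longrightarrow> (i, True) \<in> w \<longrightarrow>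
            (v \<in> V1 \<and> w \<in> V2) \<or> (v \<in> V2 \<and> w \<in> V1)))"

(* position of an endpoint on its edge *)
definition pos :: "(nat \<Rightarrow> real) \<Rightarrow> endpoint \<Rightarrow> real" where
  "pos L p = (if snd p then L (fst p) else 0)"

(* f(x_j) *)
definition endval :: "(nat \<Rightarrow> real) \<Rightarrow> (nat \<Rightarrow> real \<Rightarrow> real) \<Rightarrow> endpoint \<Rightarrow> real" where
  "endval L f p = f (fst p) (pos L p)"

(* \<partial>f(x_j), where g is the derivative f' on the edges *)
definition endder :: "(nat \<Rightarrow> real) \<Rightarrow> (nat \<Rightarrow> real \<Rightarrow> real) \<Rightarrow> endpoint \<Rightarrow> real" where
  "endder L g p = (if snd p then - g (fst p) (L (fst p)) else g (fst p) 0)"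

(* f is (extended by 0 outside the edges) a solution of -f'' = lam f on every closed edge,
   with derivative g *)
definition edge_eigen :: "nat \<Rightarrow> (nat \<Rightarrow> real) \<Rightarrow> real \<Rightarrow> (nat \<Rightarrow> real \<Rightarrow> real)
    \<Rightarrow> (nat \<Rightarrow> real \<Rightarrow> real) \<Rightarrow> bool" where
  "edge_eigen E L lam f g \<longleftrightarrow>
     (\<forall>i x. (E \<le> i \<or> x \<notin> {0..L i}) \<longrightarrow> f i x = 0) \<and>
     (\<forall>i<E. \<forall>x\<in>{0..L i}.
        (f i has_real_derivative g i x) (at x within {0..L i}) \<and>
        (g i has_real_derivative (- lam * f i x)) (at x within {0..L i}))"

(* eigenspace of the standard Laplacian for the eigenvalue candidate lam *)
definition st_eigenspace :: "nat \<Rightarrow> (nat \<Rightarrow> real) \<Rightarrow> endpoint set set \<Rightarrow> real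
    \<Rightarrow> (nat \<Rightarrow> real \<Rightarrow> real) set" where
  "st_eigenspace E L V lam = {f. \<exists>g. edge_eigen E L lam f g \<and>
      (\<forall>v\<in>V. (\<forall>p\<in>v. \<forall>q\<in>v. endval L f p = endval L f q) \<and> (\<Sum>p\<in>v. endder L g p) = 0)}"

(* eigenspace of the Dirichlet Laplacian *)
definition D_eigenspace :: "nat \<Rightarrow> (nat \<Rightarrow> real) \<Rightarrow> real \<Rightarrow> (nat \<Rightarrow> real \<Rightarrow> real) set" where
  "D_eigenspace E L lam = {f. \<exists>g. edge_eigen E L lam f g \<and>
      (\<forall>p\<in>endpoints E. endval L f p = 0)}"

definition fscale :: "real \<Rightarrow> (nat \<Rightarrow> real \<Rightarrow> real) \<Rightarrow> (nat \<Rightarrow> real \<Rightarrow> real)" where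
  "fscale c f = (\<lambda>i x. c * f i x)"

(* multiplicity = dimension of the (real) eigenspace; 0 if lam is not an eigenvalue *)
definition multiplicity_of :: "(nat \<Rightarrow> real \<Rightarrow> real) set \<Rightarrow> nat" where
  "multiplicity_of S = vector_space.dim fscale S"

(* number of eigenvalues \<le> t counted with multiplicity, for a multiplicity function m *)
definition eig_count :: "(real \<Rightarrow> nat) \<Rightarrow> real \<Rightarrow> nat" where
  "eig_count m t = (\<Sum>\<mu>\<in>{\<mu>. \<mu> \<le> t \<and> 0 < m \<mu>}. m \<mu>)"

(* the n-th eigenvalue (n \<ge> 1) in nondecreasing order, counted with multiplicities *)
definition nth_eig :: "(real \<Rightarrow> nat) \<Rightarrow> nat \<Rightarrow> real" where
  "nth_eig m n = Inf {t. n \<le> eig_count m t}"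

definition lambda_st :: "nat \<Rightarrow> (nat \<Rightarrow> real) \<Rightarrow> endpoint set set \<Rightarrow> nat \<Rightarrow> real" where
  "lambda_st E L V n = nth_eig (\<lambda>lam. multiplicity_of (st_eigenspace E L V lam)) n"

definition lambda_D :: "nat \<Rightarrow> (nat \<Rightarrow> real) \<Rightarrow> nat \<Rightarrow> real" where
  "lambda_D E L n = nth_eig (\<lambda>lam. multiplicity_of (D_eigenspace E L lam)) n"

end

(* On an edge of length l a solution of -f'' = s^2 f is determined by its two boundary values unless
   sin (s l) = 0. Away from these resonances the vertex conditions therefore say that the boundary
   values form a function on the vertices that is an eigenfunction of the averaging (random walk)
   operator of the graph, with eigenvalue cos (s l). This operator is symmetric, and
   s |-> cos (s l) maps each interval (k pi / l, (k+1) pi / l) bijectively onto (-1, 1), so every such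
   interval carries the same number of standard eigenvalues, namely the number N of eigenvalues of the
   averaging operator in (-1, 1). At s = k pi / l with e = (-1)^k the multiplicity is E - N + d(e) - d(-e),
   where d(e) is the multiplicity of the eigenvalue e of the averaging operator: d(1) = 1 by
   connectedness, and d(-1) is 1 or 0 according to whether the graph is bipartite. Hence
   E + d(e) - d(-e) standard eigenvalues fall into the k-th half-open block, against exactly E
   Dirichlet eigenvalues, all sitting at its right end; the eigenvalue 0 supplies the shift by one. *)

theory Submission
  imports Defs
begin

section \<open>Finite-dimensional spaces of real functions\<close>

text \<open>Vertex functions are stored as functions on endpoints that are constant on each vertex.
  The plain inner product over endpoints then weights a vertex by its degree, which is the weight
  that makes the random walk symmetric, and loops and multiple edges are counted automatically. With
  \<open>P\<close> the orthogonal projection \<open>avg\<close> onto vertex functions and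
  \<open>J\<close> the isometric involution \<open>\<phi> \<circ> opp\<close>, the walk is the
  compression of \<open>J\<close> to the range of \<open>P\<close>. This yields the bound 1 on its
  eigenvalues and the rigidity at 1 and -1. Since Kirchhoff's condition reads
  \<open>P \<psi> = 0\<close>, it also yields the dimension of the space of sine amplitudes at a
  resonance: among the \<open>e\<close>-odd functions they form the orthogonal complement of the
  antisymmetrised eigenbasis, which replaces a rank computation for the incidence matrix. In a
  non-bipartite graph the surplus d(e) - d(-e) alternates between -1 and 1, so the extra eigenvalue
  0 is used up at every odd level and regained at the next even one; this is the origin of the
  failures at odd multiples of \<open>E\<close>.\<close>

definition scl :: "real \<Rightarrow> ('a \<Rightarrow> real) \<Rightarrow> 'a \<Rightarrow> real" where
  "scl c f = (\<lambda>x. c * f x)"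

lemma scl_apply [simp]: "scl c f x = c * f x"
  by (simp add: scl_def)

interpretation fs: vector_space "scl :: real \<Rightarrow> ('a \<Rightarrow> real) \<Rightarrow> 'a \<Rightarrow> real"
  by unfold_locales (auto simp: fun_eq_iff algebra_simps)

lemma fscale_apply [simp]: "fscale c f i x = c * f i x"
  by (simp add: fscale_def)

interpretation gs: vector_space fscale
  by unfold_locales (auto simp: fun_eq_iff algebra_simps)

interpretation gfs: vector_space_pair fscale "scl :: real \<Rightarrow> ('a \<Rightarrow> real) \<Rightarrow> 'a \<Rightarrow> real" ..

lemma sum_fun_apply: "(\<Sum>i\<in>A. f i) x = (\<Sum>i\<in>A. f i x :: real)"
  by (induction A rule: infinite_finite_induct) auto

definition dot :: "'a set \<Rightarrow> ('a \<Rightarrow> real) \<Rightarrow> ('a \<Rightarrow> real) \<Rightarrow> real" where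
  "dot X f g = (\<Sum>x\<in>X. f x * g x)"

text \<open>Functions on \<open>X\<close> are total functions vanishing off \<open>X\<close>, so
  that agreement on \<open>X\<close> is equality and all choices of \<open>X\<close> share one
  type.\<close>

definition supp :: "'a set \<Rightarrow> ('a \<Rightarrow> real) set" where
  "supp X = {f. \<forall>x. x \<notin> X \<longrightarrow> f x = 0}"

definition orthonormal :: "'a set \<Rightarrow> ('a \<Rightarrow> real) set \<Rightarrow> bool" where
  "orthonormal X B \<longleftrightarrow> (\<forall>b\<in>B. \<forall>c\<in>B. dot X b c = (if b = c then 1 else 0))"

text \<open>Spanning is replaced by the equivalent condition that only \<open>0\<close> is orthogonal to \<open>B\<close>.\<close>
definition onb :: "'a set \<Rightarrow> ('a \<Rightarrow> real) set \<Rightarrow> ('a \<Rightarrow> real) set \<Rightarrow> bool" where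
  "onb X W B \<longleftrightarrow> finite B \<and> orthonormal X B \<and> B \<subseteq> W \<and>
     (\<forall>f\<in>W. (\<forall>b\<in>B. dot X f b = 0) \<longrightarrow> f = 0)"

lemma dot_commute: "dot X f g = dot X g f"
  by (simp add: dot_def mult.commute)

lemma dot_add_left [simp]: "dot X (f + g) h = dot X f h + dot X g h"
  by (simp add: dot_def sum.distrib algebra_simps)

lemma dot_diff_left [simp]: "dot X (f - g) h = dot X f h - dot X g h"
  by (simp add: dot_def sum_subtractf algebra_simps)

lemma dot_scl_left [simp]: "dot X (scl c f) h = c * dot X f h"
  by (simp add: dot_def sum_distrib_left algebra_simps)

lemma dot_add_right [simp]: "dot X h (f + g) = dot X h f + dot X h g"
  by (simp add: dot_def sum.distrib algebra_simps)

lemma dot_diff_right [simp]: "dot X h (f - g) = dot X h f - dot X h g"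
  by (simp add: dot_def sum_subtractf algebra_simps)

lemma dot_scl_right [simp]: "dot X h (scl c f) = c * dot X h f"
  by (simp add: dot_def sum_distrib_left algebra_simps)

lemma dot_zero [simp]: "dot X 0 h = 0" "dot X h 0 = 0"
  by (simp_all add: dot_def)

lemma dot_sum_left: "dot X (\<Sum>i\<in>A. f i) h = (\<Sum>i\<in>A. dot X (f i) h)"
  unfolding dot_def sum_fun_apply sum_distrib_right by (rule sum.swap)

lemma dot_self_nonneg: "0 \<le> dot X f f"
  by (simp add: dot_def sum_nonneg)

lemma dot_self_eq_0:
  assumes "finite X" "f \<in> supp X"
  shows "dot X f f = 0 \<longleftrightarrow> f = 0"
proof
  assume "dot X f f = 0"
  then have "\<forall>x\<in>X. f x * f x = 0"
    unfolding dot_def using assms(1) by (subst (asm) sum_nonneg_eq_0_iff) auto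
  then show "f = 0"
    using assms(2) by (auto simp: supp_def fun_eq_iff)
qed simp

lemma subspace_supp: "fs.subspace (supp X)"
  by (auto simp: fs.subspace_def supp_def)

lemma orthonormal_independent:
  assumes "orthonormal X B"
  shows "fs.independent B"
  unfolding fs.independent_explicit_finite_subsets
proof (intro allI impI ballI)
  fix A u b
  assume A: "A \<subseteq> B" "finite A" and s: "(\<Sum>v\<in>A. scl (u v) v) = 0" and b: "b \<in> A"
  have "0 = dot X (\<Sum>v\<in>A. scl (u v) v) b" by (simp add: s)
  also have "\<dots> = (\<Sum>v\<in>A. u v * dot X v b)" by (simp add: dot_sum_left)
  also have "\<dots> = (\<Sum>v\<in>A. if v = b then u v else 0)"
    using A b assms by (intro sum.cong) (auto simp: orthonormal_def subset_eq)
  also have "\<dots> = u b" using A b by simp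
  finally show "u b = 0" by simp
qed

text \<open>The indicator functions of points span \<open>supp X\<close>. The bound makes a maximal
  orthonormal set exist.\<close>

lemma orthonormal_bound:
  assumes X: "finite X" and B: "orthonormal X B" "B \<subseteq> supp X"
  shows "finite B \<and> card B \<le> card X"
proof -
  let ?D = "(\<lambda>x y. if y = x then 1 else 0 :: real) ` X"
  have "supp X \<subseteq> fs.span ?D"
  proof
    fix f assume f: "f \<in> supp X"
    have "f = (\<Sum>x\<in>X. scl (f x) (\<lambda>y. if y = x then 1 else 0))"
    proof
      fix y show "f y = (\<Sum>x\<in>X. scl (f x) (\<lambda>y. if y = x then 1 else 0)) y"
        using f X by (simp add: sum_fun_apply supp_def if_distrib[of "(*) _"] cong: if_cong)
    qed
    also have "\<dots> \<in> fs.span ?D"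
      by (intro fs.span_sum fs.span_scale fs.span_base) auto
    finally show "f \<in> fs.span ?D" .
  qed
  then have "finite B \<and> card B \<le> card ?D"
    using X B by (intro fs.independent_span_bound orthonormal_independent[of X]) auto
  then show ?thesis using card_image_le[OF X, of "\<lambda>x y. if y = x then 1 else 0 :: real"] by linarith
qed

lemma onb_dim:
  assumes W: "fs.subspace W" and B: "onb X W B"
  shows "fs.dim W = card B"
proof -
  have fin: "finite B" and on: "orthonormal X B" and sub: "B \<subseteq> W"
    and compl: "\<And>f. f \<in> W \<Longrightarrow> (\<forall>b\<in>B. dot X f b = 0) \<Longrightarrow> f = 0"
    using B by (auto simp: onb_def)
  have "W \<subseteq> fs.span B"
  proof
    fix f assume f: "f \<in> W"
    \<comment> \<open>The orthogonal projection of \<open>f\<close> to the span of \<open>B\<close>;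
      the remainder lies in \<open>W\<close> and is orthogonal to \<open>B\<close>, hence
      zero.\<close>
    let ?p = "\<Sum>b\<in>B. scl (dot X f b) b"
    have p: "?p \<in> fs.span B"
      by (intro fs.span_sum fs.span_scale fs.span_base)
    have "dot X ?p c = dot X f c" if "c \<in> B" for c
    proof -
      have "dot X ?p c = (\<Sum>b\<in>B. if b = c then dot X f b else 0)"
        using on that by (auto simp: dot_sum_left orthonormal_def intro!: sum.cong)
      then show ?thesis using fin that by simp
    qed
    moreover have "f - ?p \<in> W"
      using p sub f W by (meson fs.subspace_diff fs.span_minimal subsetD)
    ultimately have "f - ?p = 0" by (intro compl) auto
    then show "f \<in> fs.span B" using p by simp
  qed
  then show ?thesis
    using fs.basis_card_eq_dim[OF sub _ orthonormal_independent[OF on]] by simp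
qed

lemma orthonormal_insert:
  assumes "orthonormal X B" "dot X f f = 1" "\<forall>b\<in>B. dot X f b = 0"
  shows "orthonormal X (insert f B)" "f \<notin> B"
  using assms by (auto simp: orthonormal_def dot_commute)

text \<open>A maximal orthonormal set of vectors with property \<open>P\<close> is already a basis, provided that
  the orthogonal complement of any such set contains a further one unless it is trivial.\<close>
lemma onb_exists_of:
  assumes X: "finite X" and W: "W \<subseteq> supp X"
    and step: "\<And>B f0. \<lbrakk>finite B; orthonormal X B; B \<subseteq> W; \<forall>b\<in>B. P b; f0 \<in> W; f0 \<noteq> 0;
       \<forall>b\<in>B. dot X f0 b = 0\<rbrakk> \<Longrightarrow> \<exists>f\<in>W. P f \<and> dot X f f = 1 \<and> (\<forall>b\<in>B. dot X f b = 0)"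
  shows "\<exists>B. onb X W B \<and> (\<forall>b\<in>B. P b)"
proof -
  let ?Q = "\<lambda>B. orthonormal X B \<and> B \<subseteq> W \<and> (\<forall>b\<in>B. P b)"
  have "?Q {}" by (simp add: orthonormal_def)
  moreover have bd: "finite B \<and> card B \<le> card X" if "?Q B" for B
    using orthonormal_bound[OF X, of B] that W by blast
  ultimately have "\<exists>B. ?Q B \<and> (\<forall>C. ?Q C \<longrightarrow> card C \<le> card B)"
    using ex_has_greatest_nat[of ?Q "{}" card "Suc (card X)"] by (simp add: less_Suc_eq_le)
  then obtain B where B: "?Q B" and max: "\<And>C. ?Q C \<Longrightarrow> card C \<le> card B"
    by auto
  have "f = 0" if f: "f \<in> W" "\<forall>b\<in>B. dot X f b = 0" for f
  proof (rule ccontr)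
    assume "f \<noteq> 0"
    with step[of B f] f B bd obtain g where
      g: "g \<in> W" "P g" "dot X g g = 1" "\<forall>b\<in>B. dot X g b = 0" by blast
    then have "?Q (insert g B)" "g \<notin> B" using B orthonormal_insert[of X B g] by auto
    then have "card (insert g B) \<le> card B" using max by blast
    with \<open>g \<notin> B\<close> bd[OF B] show False by simp
  qed
  with B bd[OF B] show ?thesis by (auto simp: onb_def)
qed

lemma normalize:
  assumes "finite X" "f \<in> supp X" "f \<noteq> 0"
  shows "dot X (scl (1 / sqrt (dot X f f)) f) (scl (1 / sqrt (dot X f f)) f) = 1"
  using dot_self_nonneg[of X f] dot_self_eq_0[of X f] assms
  by (simp add: field_simps)

lemma onb_exists:
  assumes X: "finite X" and W: "W \<subseteq> supp X" "fs.subspace W"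
  obtains B where "onb X W B"
proof -
  have "\<exists>B. onb X W B \<and> (\<forall>b\<in>B. True)"
  proof (rule onb_exists_of[OF X W(1)])
    fix B f0 assume f0: "f0 \<in> W" "f0 \<noteq> 0" "\<forall>b\<in>B. dot X f0 b = 0"
    let ?f = "scl (1 / sqrt (dot X f0 f0)) f0"
    have "?f \<in> W" using W(2) f0 by (auto simp: fs.subspace_def)
    moreover have "dot X ?f ?f = 1" using X W(1) f0 by (intro normalize) auto
    moreover have "\<forall>b\<in>B. dot X ?f b = 0" using f0 by simp
    ultimately show "\<exists>f\<in>W. True \<and> dot X f f = 1 \<and> (\<forall>b\<in>B. dot X f b = 0)" by blast
  qed
  then show thesis using that by blast
qed

lemma orthonormal_Un:
  assumes "orthonormal X B" "orthonormal X C" "\<And>b c. b \<in> B \<Longrightarrow> c \<in> C \<Longrightarrow> dot X b c = 0"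
  shows "orthonormal X (B \<union> C)" "B \<inter> C = {}"
proof -
  show disj: "B \<inter> C = {}"
    using assms unfolding orthonormal_def by (metis disjoint_iff zero_neq_one)
  show "orthonormal X (B \<union> C)"
    unfolding orthonormal_def
  proof (intro ballI)
    fix b c assume "b \<in> B \<union> C" "c \<in> B \<union> C"
    then consider "b \<in> B" "c \<in> B" | "b \<in> C" "c \<in> C" | "b \<in> B" "c \<in> C" | "c \<in> B" "b \<in> C"
      by blast
    then show "dot X b c = (if b = c then 1 else 0)"
      using assms disj dot_commute[of X b c] by cases (auto simp: orthonormal_def)
  qed
qed

text \<open>An orthonormal basis of the complement together with \<open>B\<close> is one of
  \<open>W\<close>. This later counts the conditions that cut the flows out of the odd
  functions.\<close>

lemma dim_orthogonal_complement:
  assumes X: "finite X" and W: "W \<subseteq> supp X" "fs.subspace W"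
    and B: "finite B" "orthonormal X B" "B \<subseteq> W"
  shows "fs.dim {f\<in>W. \<forall>b\<in>B. dot X f b = 0} + card B = fs.dim W"
proof -
  let ?F = "{f\<in>W. \<forall>b\<in>B. dot X f b = 0}"
  have F: "fs.subspace ?F" using W(2) by (auto simp: fs.subspace_def)
  obtain C where C: "onb X ?F C" using onb_exists[OF X _ F] W by blast
  have "dot X b c = 0" if "b \<in> B" "c \<in> C" for b c
    using C that dot_commute[of X b c] by (auto simp: onb_def)
  then have "orthonormal X (B \<union> C)" "B \<inter> C = {}"
    using orthonormal_Un[of X B C] B(2) C by (auto simp: onb_def)
  moreover have "onb X W (B \<union> C)"
    using B C calculation(1) by (auto simp: onb_def)
  ultimately show ?thesis
    using onb_dim[OF F C] onb_dim[OF W(2), of X "B \<union> C"] B C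
    by (simp add: card_Un_disjoint onb_def)
qed

lemma dim_orthogonal_sum:
  assumes X: "finite X" and F: "F \<subseteq> supp X" "fs.subspace F" and G: "G \<subseteq> supp X" "fs.subspace G"
    and FG: "\<And>f g. f \<in> F \<Longrightarrow> g \<in> G \<Longrightarrow> dot X f g = 0"
  shows "fs.dim {f + g | f g. f \<in> F \<and> g \<in> G} = fs.dim F + fs.dim G"
proof -
  let ?S = "{f + g | f g. f \<in> F \<and> g \<in> G}"
  obtain B where B: "onb X F B" using onb_exists[OF X F] by blast
  obtain C where C: "onb X G C" using onb_exists[OF X G] by blast
  have BF: "B \<subseteq> F" and CG: "C \<subseteq> G" using B C by (auto simp: onb_def)
  have un: "orthonormal X (B \<union> C)" "B \<inter> C = {}"
    using orthonormal_Un[of X B C] B C FG BF CG by (auto simp: onb_def subset_eq)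
  have "fs.subspace ?S" by (rule fs.subspace_sums[OF F(2) G(2)])
  moreover have "onb X ?S (B \<union> C)"
    unfolding onb_def
  proof (intro conjI ballI impI)
    show "finite (B \<union> C)" using B C by (auto simp: onb_def)
    show "orthonormal X (B \<union> C)" by (rule un)
    have "0 \<in> F" "0 \<in> G" using F(2) G(2) by (auto simp: fs.subspace_def)
    then show "B \<union> C \<subseteq> ?S"
      using B C unfolding onb_def by (fastforce intro: exI[of _ 0])
    \<comment> \<open>By orthogonality, testing \<open>h\<close> against \<open>B\<close> sees only
      \<open>f\<close>, and testing against \<open>C\<close> only \<open>g\<close>.\<close>
    fix h assume h: "h \<in> ?S" "\<forall>b\<in>B \<union> C. dot X h b = 0"
    then obtain f g where fg: "h = f + g" "f \<in> F" "g \<in> G" by blast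
    have "dot X f b = 0" if "b \<in> B" for b
      using bspec[OF h(2), of b] that fg FG[OF subsetD[OF BF that] fg(3)] dot_commute[of X b g] by simp
    moreover have "dot X g b = 0" if "b \<in> C" for b
      using bspec[OF h(2), of b] that fg FG[OF fg(2) subsetD[OF CG that]] by simp
    ultimately show "h = 0" using B C fg by (auto simp: onb_def)
  qed
  ultimately have "fs.dim ?S = card (B \<union> C)" by (rule onb_dim)
  then show ?thesis
    using un onb_dim[OF F(2) B] onb_dim[OF G(2) C] B C
    by (simp add: card_Un_disjoint onb_def)
qed

section \<open>Spectral theorem for symmetric operators on functions on a finite set\<close>

lemma closed_supp: "closed (supp X)"
proof -
  have "supp X = (\<Inter>x\<in>-X. {f. f x = 0})" by (auto simp: supp_def)
  then show ?thesis
    by (auto intro!: closed_INT closed_Collect_eq continuous_on_const)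
qed

lemma continuous_on_dot:
  assumes "\<And>x. continuous_on S (\<lambda>f. p f x)" "\<And>x. continuous_on S (\<lambda>f. q f x)"
  shows "continuous_on S (\<lambda>f. dot X (p f) (q f))"
  unfolding dot_def by (intro continuous_intros assms)

text \<open>In the product topology the sphere is a closed part of a product of compact sets,
  \<open>{-1..1}\<close> on \<open>X\<close> and \<open>{0}\<close> elsewhere, so Tychonoff
  applies.\<close>

lemma compact_unit_sphere:
  assumes X: "finite X" and W: "W \<subseteq> supp X" "closed W"
  shows "compact {f\<in>W. dot X f f = 1}"
proof -
  let ?C = "PiE UNIV (\<lambda>x. if x \<in> X then {-1..1} else {0 :: real})"
  have "compactin (product_topology (\<lambda>i. euclidean) UNIV) ?C"
    by (subst compactin_PiE) auto
  then have "compact ?C"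
    unfolding euclidean_product_topology compactin_euclidean_iff .
  moreover have "closed {f\<in>W. dot X f f = 1}"
    unfolding Collect_conj_eq
    by (intro closed_Int closed_Collect_eq continuous_on_dot) (use W in \<open>auto intro: continuous_on_const\<close>)
  moreover have "{f\<in>W. dot X f f = 1} \<subseteq> ?C"
  proof (intro subsetI PiE_I)
    fix f x assume "f \<in> {f\<in>W. dot X f f = 1}"
    then have f: "f \<in> W" "dot X f f = 1" by auto
    show "f x \<in> (if x \<in> X then {-1..1} else {0})"
    proof (cases "x \<in> X")
      case False
      then show ?thesis using f W by (auto simp: supp_def)
    next
      case True
      then have "f x * f x \<le> 1"
        using f(2) member_le_sum[of x X "\<lambda>x. f x * f x"] X by (auto simp: dot_def)
      then have "\<bar>f x\<bar> \<le> 1" using abs_le_square_iff[of "f x" 1] by (simp add: power2_eq_square)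
      then show ?thesis using True by auto
    qed
  qed auto
  ultimately show ?thesis
    using compact_Int_closed[of ?C "{f\<in>W. dot X f f = 1}"] by (simp add: Int_absorb1)
qed

text \<open>A maximiser \<open>f\<close> of the Rayleigh quotient is an eigenvector: moving from \<open>f\<close> in the
  direction of \<open>T f - \<mu> f\<close> cannot increase the quotient.\<close>
lemma symmetric_has_eigenvector:
  assumes X: "finite X" and W: "W \<subseteq> supp X" "fs.subspace W" "closed W" and f0: "f0 \<in> W" "f0 \<noteq> 0"
    and TW: "\<And>f. f \<in> W \<Longrightarrow> T f \<in> W"
    and Tadd: "\<And>f g. T (f + g) = T f + T g" and Tscl: "\<And>c f. T (scl c f) = scl c (T f)"
    and Tcont: "\<And>x. continuous_on UNIV (\<lambda>f. T f x)"
    and Tsym: "\<And>f g. f \<in> W \<Longrightarrow> g \<in> W \<Longrightarrow> dot X (T f) g = dot X f (T g)"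
  obtains f \<mu> where "f \<in> W" "dot X f f = 1" "T f = scl \<mu> f"
proof -
  let ?S = "{f\<in>W. dot X f f = 1}"
  have unit: "scl (1 / sqrt (dot X h h)) h \<in> ?S" if "h \<in> W" "h \<noteq> 0" for h
  proof -
    have "scl (1 / sqrt (dot X h h)) h \<in> W" using W(2) that by (auto simp: fs.subspace_def)
    moreover note normalize[of X h]
    ultimately show ?thesis using X W(1) that by auto
  qed
  have "continuous_on ?S (\<lambda>f. dot X (T f) f)"
    by (intro continuous_on_dot continuous_on_subset[OF Tcont]
        continuous_on_subset[OF continuous_on_product_coordinates]) auto
  moreover have "?S \<noteq> {}" using unit[OF f0] by blast
  ultimately obtain f where f: "f \<in> ?S" and max: "\<And>h. h \<in> ?S \<Longrightarrow> dot X (T h) h \<le> dot X (T f) f"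
    using continuous_attains_sup[OF compact_unit_sphere[OF X W(1,3)]] by blast
  define \<mu> where "\<mu> = dot X (T f) f"
  \<comment> \<open>Maximality on the sphere, rescaled to a quadratic inequality on all of
    \<open>W\<close>.\<close>
  have q: "dot X (T h) h \<le> \<mu> * dot X h h" if "h \<in> W" for h
  proof (cases "h = 0")
    case True
    then show ?thesis by simp
  next
    case False
    have pos: "dot X h h > 0"
      using dot_self_nonneg[of X h] dot_self_eq_0[of X h] False X W(1) that by force
    have "dot X (T h) h / dot X h h \<le> \<mu>"
      using max[OF unit[OF that False]] pos by (simp add: Tscl \<mu>_def)
    then show ?thesis using pos by (simp add: field_simps)
  qed
  define g where "g = T f - scl \<mu> f"
  have gW: "g \<in> W"
    using W(2) TW f unfolding g_def by (intro fs.subspace_diff) (auto simp: fs.subspace_def)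
  define c where "c = \<mu> * dot X g g - dot X (T g) g"
  have gg: "dot X (T f) g = \<mu> * dot X f g + dot X g g"
  proof -
    have "dot X g g = dot X (T f) g - \<mu> * dot X f g" by (subst (1) g_def) simp
    then show ?thesis by simp
  qed
  \<comment> \<open>Inserting \<open>f + scl t g\<close> into \<open>q\<close>: the first-order gain
    \<open>2 * t * dot X g g\<close> must be absorbed by the second-order term for every
    \<open>t\<close>.\<close>
  have tc: "2 * t * dot X g g \<le> t * t * c" for t
  proof -
    have "f + scl t g \<in> W" using W(2) f gW by (auto simp: fs.subspace_def)
    then have "dot X (T (f + scl t g)) (f + scl t g) \<le> \<mu> * dot X (f + scl t g) (f + scl t g)"
      by (rule q)
    also have "dot X (T (f + scl t g)) (f + scl t g)
        = \<mu> + t * dot X (T f) g + t * dot X (T g) f + t * t * dot X (T g) g"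
      by (simp add: Tadd Tscl \<mu>_def algebra_simps)
    also have "dot X (T g) f = dot X (T f) g"
      using Tsym[OF gW, of f] f dot_commute[of X g "T f"] by simp
    also have "dot X (f + scl t g) (f + scl t g) = 1 + 2 * t * dot X f g + t * t * dot X g g"
      using f dot_commute[of X g f] by (simp add: algebra_simps)
    finally show ?thesis
      unfolding gg c_def by (simp add: algebra_simps)
  qed
  have "dot X g g = 0"
  proof (rule ccontr)
    assume "dot X g g \<noteq> 0"
    then have a: "dot X g g > 0" using dot_self_nonneg[of X g] by linarith
    \<comment> \<open>Small enough that \<open>t * c\<close> is at most \<open>dot X g g\<close>,
      while \<open>tc\<close> demands twice that; the added 1 keeps the denominator
      positive.\<close>
    define t where "t = dot X g g / (\<bar>c\<bar> + 1)"
    have t: "t > 0" using a by (simp add: t_def add_nonneg_pos)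
    have "2 * dot X g g \<le> t * c" using tc[of t] t by (simp add: mult.assoc)
    also have "\<dots> \<le> t * (\<bar>c\<bar> + 1)" using t by (intro mult_left_mono) auto
    also have "\<dots> = dot X g g" by (simp add: t_def)
    finally show False using a by simp
  qed
  then have "g = 0" using dot_self_eq_0[OF X] gW W(1) by blast
  then show thesis using that[of f \<mu>] f by (auto simp: g_def)
qed

theorem symmetric_onb_of_eigenvectors:
  assumes X: "finite X" and W: "W \<subseteq> supp X" "fs.subspace W" "closed W"
    and TW: "\<And>f. f \<in> W \<Longrightarrow> T f \<in> W"
    and Tadd: "\<And>f g. T (f + g) = T f + T g" and Tscl: "\<And>c f. T (scl c f) = scl c (T f)"
    and Tcont: "\<And>x. continuous_on UNIV (\<lambda>f. T f x)"
    and Tsym: "\<And>f g. f \<in> W \<Longrightarrow> g \<in> W \<Longrightarrow> dot X (T f) g = dot X f (T g)"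
  obtains B \<mu> where "onb X W B" "\<And>b. b \<in> B \<Longrightarrow> T b = scl (\<mu> b) b"
proof -
  have "\<exists>B. onb X W B \<and> (\<forall>b\<in>B. \<exists>m. T b = scl m b)"
  proof (rule onb_exists_of[OF X W(1)])
    fix B f0
    assume B: "finite B" "orthonormal X B" "B \<subseteq> W" "\<forall>b\<in>B. \<exists>m. T b = scl m b"
      and f0: "f0 \<in> W" "f0 \<noteq> 0" "\<forall>b\<in>B. dot X f0 b = 0"
    let ?F = "{f\<in>W. \<forall>b\<in>B. dot X f b = 0}"
    have 1: "?F \<subseteq> supp X" using W by auto
    have 2: "fs.subspace ?F" using W(2) by (auto simp: fs.subspace_def)
    have "?F = W \<inter> (\<Inter>b\<in>B. {f. dot X f b = 0})" by auto
    then have 3: "closed ?F"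
      using W(3) by (auto intro!: closed_Int closed_INT closed_Collect_eq continuous_on_dot continuous_on_const)
    \<comment> \<open>Symmetry moves \<open>T\<close> onto the eigenvectors in \<open>B\<close>, so
      their complement is invariant and contains a further eigenvector.\<close>
    have 4: "T f \<in> ?F" if "f \<in> ?F" for f
    proof -
      have "dot X (T f) b = 0" if b: "b \<in> B" for b
      proof -
        obtain m where "T b = scl m b" using B b by blast
        then show ?thesis using Tsym[of f b] \<open>f \<in> ?F\<close> b B(3) by auto
      qed
      then show ?thesis using TW that by auto
    qed
    obtain f m where "f \<in> ?F" "dot X f f = 1" "T f = scl m f"
      by (rule symmetric_has_eigenvector[OF X 1 2 3, of f0 T]) (use f0 4 Tadd Tscl Tcont Tsym in auto)
    then show "\<exists>f\<in>W. (\<exists>m. T f = scl m f) \<and> dot X f f = 1 \<and> (\<forall>b\<in>B. dot X f b = 0)" by blast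
  qed
  then obtain B where B: "onb X W B" "\<forall>b\<in>B. \<exists>m. T b = scl m b" by blast
  then obtain \<mu> where "\<forall>b\<in>B. T b = scl (\<mu> b) b" by metis
  with B that show thesis by blast
qed

text \<open>Transports a multiplicity from functions on edges to finitely many boundary data, where
  dimensions can be counted.\<close>

lemma dim_image_inj:
  assumes h: "Vector_Spaces.linear fscale scl h" and S: "gs.subspace S" and inj: "inj_on h S"
  shows "gs.dim S = fs.dim (h ` S)"
proof -
  obtain A where A: "A \<subseteq> S" "gs.independent A" "S \<subseteq> gs.span A" "card A = gs.dim S"
    using gs.basis_exists by blast
  have sp: "gs.span A = S" using A S by (metis gs.span_minimal subset_antisym)
  have "fs.independent (h ` A)"
    using gfs.linear_independent_injective_image[OF h, of A] A(2) inj sp by simp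
  moreover have "h ` S \<subseteq> fs.span (h ` A)"
    using gfs.linear_span_image[OF h, of A] sp by simp
  ultimately have "card (h ` A) = fs.dim (h ` S)"
    using A(1) by (intro fs.basis_card_eq_dim) auto
  then show ?thesis using A inj by (metis card_image inj_on_subset)
qed

section \<open>The averaging operator of the graph\<close>

definition opp :: "endpoint \<Rightarrow> endpoint" where
  "opp p = (fst p, \<not> snd p)"

lemma opp_simps [simp]: "opp (i, b) = (i, \<not> b)" "opp (opp p) = p" "fst (opp p) = fst p" "snd (opp p) \<longleftrightarrow> \<not> snd p"
  by (simp_all add: opp_def)

lemma opp_in_endpoints [simp]: "opp p \<in> endpoints E \<longleftrightarrow> p \<in> endpoints E"
  by (simp add: endpoints_def)

lemma endpoints_eq: "endpoints E = {..<E} \<times> UNIV"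
  by (auto simp: endpoints_def)

lemma finite_endpoints [simp]: "finite (endpoints E)"
  by (simp add: endpoints_eq)

lemma sum_endpoints: "(\<Sum>p\<in>endpoints E. h p) = (\<Sum>i<E. h (i, False) + h (i, True))"
proof -
  have "(\<Sum>p\<in>endpoints E. h p) = (\<Sum>i<E. \<Sum>b\<in>UNIV. h (i, b))"
    by (simp add: endpoints_eq sum.cartesian_product)
  then show ?thesis by (simp add: UNIV_bool add.commute)
qed

lemma sum_opp: "(\<Sum>p\<in>endpoints E. h (opp p)) = (\<Sum>p\<in>endpoints E. h p)"
  by (simp add: sum_endpoints add.commute)

locale equilateral_graph =
  fixes E :: nat and L :: "nat \<Rightarrow> real" and V :: "endpoint set set" and l :: real
  assumes E_pos: "0 < E" and l_pos: "0 < l" and L_eq: "\<And>i. i < E \<Longrightarrow> L i = l"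
    and part: "partition_on (endpoints E) V" and conn: "graph_connected E V"
begin

abbreviation X :: "endpoint set" where "X \<equiv> endpoints E"

definition vertex :: "endpoint \<Rightarrow> endpoint set" where
  "vertex p = (THE v. v \<in> V \<and> p \<in> v)"

lemma vertex_eq: "v \<in> V \<Longrightarrow> p \<in> v \<Longrightarrow> vertex p = v"
  unfolding vertex_def using part by (intro the_equality) (auto simp: partition_on_def disjoint_def)

lemma in_X: "v \<in> V \<Longrightarrow> p \<in> v \<Longrightarrow> p \<in> X"
  using part by (auto simp: partition_on_def)

lemma vertex_in:
  assumes "p \<in> X"
  shows "vertex p \<in> V" "p \<in> vertex p"
proof -
  obtain v where "v \<in> V" "p \<in> v" using assms part unfolding partition_on_def by blast
  then show "vertex p \<in> V" "p \<in> vertex p" using vertex_eq by auto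
qed

lemma finite_vertex: "v \<in> V \<Longrightarrow> finite v"
  by (rule finite_subset[of _ X]) (auto intro: in_X)

lemma vertex_nonempty: "v \<in> V \<Longrightarrow> \<exists>p. p \<in> v"
  using part unfolding partition_on_def by (metis ex_in_conv)

lemma card_vertex: "v \<in> V \<Longrightarrow> 0 < card v"
  using finite_vertex part by (auto simp: partition_on_def card_gt_0_iff)

lemma sum_vertices: "(\<Sum>p\<in>X. h p) = (\<Sum>v\<in>V. \<Sum>p\<in>v. h p)" for h :: "endpoint \<Rightarrow> real"
proof -
  have "X = \<Union> V" using part by (simp add: partition_on_def)
  then show ?thesis
    using part finite_vertex by (simp add: partition_on_def disjoint_def sum.Union_disjoint)
qed

definition vertex_funs :: "(endpoint \<Rightarrow> real) set" where
  "vertex_funs = {\<phi>\<in>supp X. \<forall>v\<in>V. \<forall>p\<in>v. \<forall>q\<in>v. \<phi> p = \<phi> q}"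

definition avg :: "(endpoint \<Rightarrow> real) \<Rightarrow> endpoint \<Rightarrow> real" where
  "avg \<psi> p = (if p \<in> X then (\<Sum>q\<in>vertex p. \<psi> q) / card (vertex p) else 0)"

text \<open>\<open>\<phi> \<circ> opp\<close> reads the value at the far end of each edge, so this
  is the random walk operator.\<close>

definition transition :: "(endpoint \<Rightarrow> real) \<Rightarrow> endpoint \<Rightarrow> real" where
  "transition \<phi> = avg (\<phi> \<circ> opp)"

lemma vertex_funsI:
  assumes "\<And>p. p \<notin> X \<Longrightarrow> \<phi> p = 0" "\<And>v p q. v \<in> V \<Longrightarrow> p \<in> v \<Longrightarrow> q \<in> v \<Longrightarrow> \<phi> p = \<phi> q"
  shows "\<phi> \<in> vertex_funs"
  using assms unfolding vertex_funs_def supp_def by blast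

lemma vertex_funsD:
  assumes "\<phi> \<in> vertex_funs"
  shows "p \<notin> X \<Longrightarrow> \<phi> p = 0" "v \<in> V \<Longrightarrow> p \<in> v \<Longrightarrow> q \<in> v \<Longrightarrow> \<phi> p = \<phi> q"
  using assms unfolding vertex_funs_def supp_def by blast+

lemma vertex_funs_vertex: "\<phi> \<in> vertex_funs \<Longrightarrow> p \<in> X \<Longrightarrow> q \<in> vertex p \<Longrightarrow> \<phi> q = \<phi> p"
  using vertex_in vertex_funsD(2) by blast

lemma vertex_funs_supp: "vertex_funs \<subseteq> supp X"
  by (auto simp: vertex_funs_def)

lemma subspace_vertex_funs: "fs.subspace vertex_funs"
proof (rule fs.subspaceI)
  fix \<phi> \<psi> :: "endpoint \<Rightarrow> real" and c
  assume phi: "\<phi> \<in> vertex_funs"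
  show "scl c \<phi> \<in> vertex_funs"
  proof (rule vertex_funsI)
    show "scl c \<phi> p = scl c \<phi> q" if "v \<in> V" "p \<in> v" "q \<in> v" for v p q
      using vertex_funsD(2)[OF phi that] by simp
  qed (simp add: vertex_funsD(1)[OF phi])
  assume psi: "\<psi> \<in> vertex_funs"
  show "\<phi> + \<psi> \<in> vertex_funs"
  proof (rule vertex_funsI)
    show "(\<phi> + \<psi>) p = (\<phi> + \<psi>) q" if "v \<in> V" "p \<in> v" "q \<in> v" for v p q
      using vertex_funsD(2)[OF phi that] vertex_funsD(2)[OF psi that] by simp
  qed (simp add: vertex_funsD(1)[OF phi] vertex_funsD(1)[OF psi])
qed (auto intro: vertex_funsI)

lemma closed_vertex_funs: "closed vertex_funs"
proof -
  have "vertex_funs = supp X \<inter> (\<Inter>v\<in>V. \<Inter>p\<in>v. \<Inter>q\<in>v. {\<phi>. \<phi> p = \<phi> q})"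
    by (auto simp: vertex_funs_def)
  then show ?thesis
    using closed_supp by (auto intro!: closed_Int closed_INT closed_Collect_eq)
qed

lemma avg_vertex: "v \<in> V \<Longrightarrow> p \<in> v \<Longrightarrow> avg \<psi> p = (\<Sum>q\<in>v. \<psi> q) / card v"
  using vertex_eq in_X by (simp add: avg_def)

lemma avg_in: "avg \<psi> \<in> vertex_funs"
  using avg_vertex by (auto simp: vertex_funs_def supp_def avg_def)

text \<open>Turns Kirchhoff's condition at all vertices into a single equation.\<close>

lemma avg_eq_0_iff: "avg \<psi> = 0 \<longleftrightarrow> (\<forall>v\<in>V. (\<Sum>p\<in>v. \<psi> p) = 0)"
proof
  assume a: "avg \<psi> = 0"
  show "\<forall>v\<in>V. (\<Sum>p\<in>v. \<psi> p) = 0"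
  proof
    fix v assume v: "v \<in> V"
    then obtain p where "p \<in> v" using vertex_nonempty by blast
    then show "(\<Sum>p\<in>v. \<psi> p) = 0"
      using avg_vertex[OF v, of p \<psi>] card_vertex[OF v] a by simp
  qed
next
  assume "\<forall>v\<in>V. (\<Sum>p\<in>v. \<psi> p) = 0"
  then show "avg \<psi> = 0" using vertex_in by (auto simp: avg_def fun_eq_iff)
qed

text \<open>On a vertex \<open>\<phi>\<close> is constant, and \<open>\<psi>\<close> and its mean
  have the same sum. With \<open>avg_in\<close> this says that \<open>avg\<close> is the orthogonal
  projection onto \<open>vertex_funs\<close>.\<close>

lemma dot_avg:
  assumes "\<phi> \<in> vertex_funs"
  shows "dot X (avg \<psi>) \<phi> = dot X \<psi> \<phi>"
  unfolding dot_def sum_vertices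
proof (rule sum.cong[OF refl])
  fix v assume v: "v \<in> V"
  then obtain p where p: "p \<in> v" using vertex_nonempty by blast
  define c where "c = \<phi> p"
  have c: "\<phi> q = c" if "q \<in> v" for q using vertex_funsD(2)[OF assms v that p] by (simp add: c_def)
  have "(\<Sum>q\<in>v. avg \<psi> q * \<phi> q) = (\<Sum>q\<in>v. (\<Sum>r\<in>v. \<psi> r) / card v * c)"
    using avg_vertex[OF v] c by (intro sum.cong) auto
  also have "\<dots> = (\<Sum>q\<in>v. \<psi> q * c)"
    using card_vertex[OF v] by (simp add: sum_distrib_right)
  also have "\<dots> = (\<Sum>q\<in>v. \<psi> q * \<phi> q)" using c by (intro sum.cong) auto
  finally show "(\<Sum>q\<in>v. avg \<psi> q * \<phi> q) = (\<Sum>q\<in>v. \<psi> q * \<phi> q)" .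
qed

lemma dot_opp: "dot X (\<phi> \<circ> opp) \<psi> = dot X \<phi> (\<psi> \<circ> opp)"
  unfolding dot_def using sum_opp[of "\<lambda>p. \<phi> p * \<psi> (opp p)"] by simp

lemma dot_opp_opp [simp]: "dot X (\<phi> \<circ> opp) (\<psi> \<circ> opp) = dot X \<phi> \<psi>"
  by (subst dot_opp) (simp add: o_def)

lemma transition_sym:
  assumes "\<phi> \<in> vertex_funs" "\<psi> \<in> vertex_funs"
  shows "dot X (transition \<phi>) \<psi> = dot X \<phi> (transition \<psi>)"
proof -
  have "dot X (transition \<phi>) \<psi> = dot X (\<psi> \<circ> opp) \<phi>"
    using dot_avg[OF assms(2), of "\<phi> \<circ> opp"] dot_commute[of X \<phi>]
    by (simp add: transition_def dot_opp)
  then show ?thesis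
    using dot_avg[OF assms(1), of "\<psi> \<circ> opp"] dot_commute[of X \<phi>] by (simp add: transition_def)
qed

lemma transition_add: "transition (\<phi> + \<psi>) = transition \<phi> + transition \<psi>"
  by (auto simp: transition_def avg_def fun_eq_iff sum.distrib add_divide_distrib)

lemma transition_scl: "transition (scl c \<phi>) = scl c (transition \<phi>)"
  by (auto simp: transition_def avg_def fun_eq_iff sum_distrib_left)

lemma transition_continuous: "continuous_on UNIV (\<lambda>\<phi>. transition \<phi> p)"
proof (cases "p \<in> X")
  case True
  then have "0 < card (vertex p)" using card_vertex vertex_in by blast
  then show ?thesis unfolding transition_def avg_def using True by (auto intro!: continuous_intros)
next
  case False
  then show ?thesis by (simp add: transition_def avg_def)
qed

lemma eigenbasis:
  obtains B \<mu> where "onb X vertex_funs B" "\<And>b. b \<in> B \<Longrightarrow> transition b = scl (\<mu> b) b"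
proof (rule symmetric_onb_of_eigenvectors[of X vertex_funs transition])
  show "transition f \<in> vertex_funs" for f by (simp add: transition_def avg_in)
qed (use vertex_funs_supp subspace_vertex_funs closed_vertex_funs transition_add transition_scl transition_continuous
  transition_sym that in auto)

text \<open>Reversal preserves the norm, and \<open>dot X (\<phi> \<circ> opp) \<phi>\<close>
  becomes \<open>m * dot X \<phi> \<phi>\<close> after projecting. For \<open>e\<close> equal to 1
  or -1 this gives both the spectral bound and its equality case.\<close>

lemma norm_opp_diff:
  assumes "\<phi> \<in> vertex_funs" "transition \<phi> = scl m \<phi>"
  shows "dot X ((\<phi> \<circ> opp) - scl e \<phi>) ((\<phi> \<circ> opp) - scl e \<phi>) = (1 - 2 * e * m + e\<^sup>2) * dot X \<phi> \<phi>"
proof -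
  have "dot X (\<phi> \<circ> opp) \<phi> = m * dot X \<phi> \<phi>"
    using dot_avg[OF assms(1), of "\<phi> \<circ> opp"] assms(2) by (simp add: transition_def)
  then show ?thesis
    using dot_commute[of X \<phi> "\<phi> \<circ> opp"] by (simp add: algebra_simps power2_eq_square)
qed

lemma transition_eigenvalue_bound:
  assumes "\<phi> \<in> vertex_funs" "transition \<phi> = scl m \<phi>" "\<phi> \<noteq> 0"
  shows "\<bar>m\<bar> \<le> 1"
proof -
  have pos: "dot X \<phi> \<phi> > 0"
    using dot_self_nonneg[of X \<phi>] dot_self_eq_0[of X \<phi>] vertex_funs_supp assms by force
  have "0 \<le> (1 - 2 * e * m + e\<^sup>2)" for e
    using norm_opp_diff[OF assms(1,2), of e] pos dot_self_nonneg[of X "(\<phi> \<circ> opp) - scl e \<phi>"]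
    by (simp add: zero_le_mult_iff)
  from this[of 1] this[of "-1"] show ?thesis by simp
qed

text \<open>\<open>transition\<close> is a compression of the isometry \<open>\<phi> \<mapsto> \<phi> \<circ> opp\<close>, so on eigenvectors for
  \<open>\<plusminus>1\<close> the two agree.\<close>
lemma transition_eq_sign_iff:
  assumes "\<phi> \<in> vertex_funs" and e: "e = 1 \<or> e = -1"
  shows "transition \<phi> = scl e \<phi> \<longleftrightarrow> \<phi> \<circ> opp = scl e \<phi>"
proof
  \<comment> \<open>With \<open>m = e\<close> the factor in \<open>norm_opp_diff\<close> is
    \<open>1 - 2 * e\<^sup>2 + e\<^sup>2\<close>, which is 0 here.\<close>
  assume "transition \<phi> = scl e \<phi>"
  then have "dot X ((\<phi> \<circ> opp) - scl e \<phi>) ((\<phi> \<circ> opp) - scl e \<phi>) = 0"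
    using norm_opp_diff[OF assms(1), of e e] e by auto
  moreover have "(\<phi> \<circ> opp) - scl e \<phi> \<in> supp X"
    using vertex_funsD(1)[OF assms(1), of "opp _"] vertex_funsD(1)[OF assms(1)]
    unfolding supp_def by (intro CollectI allI impI) simp
  ultimately have "(\<phi> \<circ> opp) - scl e \<phi> = 0" using dot_self_eq_0[OF finite_endpoints] by blast
  then show "\<phi> \<circ> opp = scl e \<phi>" by simp
next
  assume "\<phi> \<circ> opp = scl e \<phi>"
  then have "transition \<phi> p = scl e \<phi> p" for p
  proof (cases "p \<in> X")
    case True
    have "transition \<phi> p = (\<Sum>q\<in>vertex p. e * \<phi> q) / card (vertex p)"
      unfolding transition_def \<open>\<phi> \<circ> opp = scl e \<phi>\<close> using True by (simp add: avg_def)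
    also have "\<dots> = (\<Sum>q\<in>vertex p. e * \<phi> p) / card (vertex p)"
      using vertex_funs_vertex[OF assms(1) True] by (intro arg_cong2[where f="(/)"] sum.cong) auto
    finally show ?thesis using card_vertex[of "vertex p"] vertex_in[OF True] by simp
  next
    case False
    then show ?thesis using vertex_funsD(1)[OF assms(1)] by (simp add: transition_def avg_def)
  qed
  then show "transition \<phi> = scl e \<phi>" by auto
qed

text \<open>At a resonance, with \<open>e = cos (s l)\<close>, the cosine parts of the standard eigenfunctions
  have their boundary values in \<open>even_funs e\<close>, the sine parts their derivatives in \<open>flows e\<close>.\<close>
definition even_funs :: "real \<Rightarrow> (endpoint \<Rightarrow> real) set" where
  "even_funs e = {\<phi>\<in>vertex_funs. \<phi> \<circ> opp = scl e \<phi>}"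

text \<open>For \<open>e = cos (s * l)\<close> at a resonance these are, up to the factor
  \<open>s\<close>, the end derivatives of arbitrary sine amplitudes, one free value per
  edge.\<close>

definition odd_funs :: "real \<Rightarrow> (endpoint \<Rightarrow> real) set" where
  "odd_funs e = {\<psi>\<in>supp X. \<psi> \<circ> opp = scl (- e) \<psi>}"

definition flows :: "real \<Rightarrow> (endpoint \<Rightarrow> real) set" where
  "flows e = {\<psi>\<in>odd_funs e. avg \<psi> = 0}"

lemma even_funsI: "\<phi> \<in> vertex_funs \<Longrightarrow> (\<And>p. \<phi> (opp p) = e * \<phi> p) \<Longrightarrow> \<phi> \<in> even_funs e"
  unfolding even_funs_def by (auto intro!: ext)

lemma even_funsD:
  assumes "\<phi> \<in> even_funs e"
  shows "\<phi> \<in> vertex_funs" "\<phi> (opp p) = e * \<phi> p"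
  using assms unfolding even_funs_def by (auto dest: fun_cong[of _ _ p])

lemma odd_funsI: "(\<And>p. p \<notin> X \<Longrightarrow> \<psi> p = 0) \<Longrightarrow> (\<And>p. \<psi> (opp p) = - e * \<psi> p) \<Longrightarrow> \<psi> \<in> odd_funs e"
  unfolding odd_funs_def supp_def by (auto intro!: ext)

lemma odd_funsD:
  assumes "\<psi> \<in> odd_funs e"
  shows "p \<notin> X \<Longrightarrow> \<psi> p = 0" "\<psi> (opp p) = - e * \<psi> p"
  using assms unfolding odd_funs_def supp_def by (blast, auto dest: fun_cong[of _ _ p])

lemma subspace_even_funs: "fs.subspace (even_funs e)"
  using subspace_vertex_funs by (auto simp: fs.subspace_def even_funs_def fun_eq_iff algebra_simps)

lemma subspace_odd_funs: "fs.subspace (odd_funs e)"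
  using subspace_supp[of X] by (auto simp: fs.subspace_def odd_funs_def fun_eq_iff algebra_simps)

lemma subspace_flows: "fs.subspace (flows e)"
  using subspace_odd_funs[of e]
  by (auto simp: fs.subspace_def flows_def avg_eq_0_iff sum.distrib simp flip: sum_distrib_left)

text \<open>Every step of a connecting chain preserves the value: inside a vertex by continuity,
  along an edge by invariance under \<open>opp\<close>.\<close>

lemma even_funs_1_constant:
  assumes "\<phi> \<in> even_funs 1"
  obtains c where "\<And>p. p \<in> X \<Longrightarrow> \<phi> p = c"
proof -
  let ?r = "{(a, b). (\<exists>v\<in>V. a \<in> v \<and> b \<in> v) \<or> fst a = fst b}"
  have W: "\<phi> \<in> vertex_funs" and o: "\<And>p. \<phi> (opp p) = \<phi> p"
    using even_funsD[OF assms] by simp_all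
  have step: "\<phi> a = \<phi> b" if ab: "(a, b) \<in> ?r" for a b
  proof -
    consider "\<exists>v\<in>V. a \<in> v \<and> b \<in> v" | "fst a = fst b" using ab by auto
    then show ?thesis
    proof cases
      case 1
      then show ?thesis using vertex_funsD(2)[OF W] by blast
    next
      case 2
      then have "b = a \<or> b = opp a" by (cases a, cases b) auto
      then show ?thesis using o[of a] by auto
    qed
  qed
  have "\<phi> p = \<phi> q" if "p \<in> X" "q \<in> X" for p q
  proof -
    have "(p, q) \<in> ?r\<^sup>*" using conn that by (auto simp: graph_connected_def)
    then show ?thesis by (induction rule: rtrancl_induct) (use step in auto)
  qed
  moreover have "(0, False) \<in> X" using E_pos by (simp add: endpoints_def)
  ultimately show thesis using that by blast
qed

lemma dim_even_funs_1: "fs.dim (even_funs 1) = 1"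
proof -
  let ?u = "\<lambda>p. if p \<in> X then 1 else 0 :: real"
  have u: "?u \<in> even_funs 1"
    using in_X by (intro even_funsI vertex_funsI) auto
  have "even_funs 1 \<subseteq> fs.span {?u}"
  proof
    fix \<phi> assume phi: "\<phi> \<in> even_funs 1"
    then obtain c where "\<And>p. p \<in> X \<Longrightarrow> \<phi> p = c" by (rule even_funs_1_constant) blast
    then have "\<phi> = scl c ?u" using vertex_funsD(1)[OF even_funsD(1)[OF phi]] by (intro ext) simp
    then show "\<phi> \<in> fs.span {?u}" by (metis fs.span_base fs.span_scale insertI1)
  qed
  moreover have "?u (0, False) \<noteq> 0" using E_pos by (simp add: endpoints_def)
  then have "?u \<noteq> 0" by (intro notI, drule_tac fun_cong[of _ _ "(0, False)"]) simp
  then have "fs.independent {?u}" by simp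
  ultimately show ?thesis
    using fs.basis_card_eq_dim[of "{?u}" "even_funs 1"] u by simp
qed

text \<open>Absolute values turn the sign change along each edge into invariance, so connectedness
  applies.\<close>

lemma even_funs_minus_1:
  assumes "\<phi> \<in> even_funs (-1)"
  obtains c where "\<And>p. p \<in> X \<Longrightarrow> \<bar>\<phi> p\<bar> = c"
proof -
  have o: "\<phi> (opp p) = - \<phi> p" for p using even_funsD(2)[OF assms] by simp
  have "(\<lambda>p. \<bar>\<phi> p\<bar>) \<in> even_funs 1"
  proof (intro even_funsI vertex_funsI)
    show "\<bar>\<phi> p\<bar> = \<bar>\<phi> q\<bar>" if "v \<in> V" "p \<in> v" "q \<in> v" for v p q
      using vertex_funsD(2)[OF even_funsD(1)[OF assms] that] by simp
  qed (use o vertex_funsD(1)[OF even_funsD(1)[OF assms]] in auto)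
  then show thesis by (rule even_funs_1_constant) (use that in blast)
qed

text \<open>Colour the two vertex classes by 1 and -1; conversely the sign of a nonzero function in
  \<open>even_funs (-1)\<close> is a proper colouring.\<close>

lemma bipartite_iff: "bipartite E V \<longleftrightarrow> even_funs (-1) \<noteq> {0}"
proof
  assume "bipartite E V"
  then obtain V1 V2 where V12: "V1 \<union> V2 = V" "V1 \<inter> V2 = {}"
    and e: "\<forall>i<E. \<forall>v\<in>V. \<forall>w\<in>V. (i, False) \<in> v \<longrightarrow> (i, True) \<in> w \<longrightarrow>
            (v \<in> V1 \<and> w \<in> V2) \<or> (v \<in> V2 \<and> w \<in> V1)"
    unfolding bipartite_def by (elim exE conjE) (rule that)
  let ?u = "\<lambda>p. if p \<in> X then (if vertex p \<in> V1 then 1 else -1) else 0 :: real"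
  have "?u (opp p) = - ?u p" for p
  proof (cases "p \<in> X")
    case True
    obtain i b where p: "p = (i, b)" by (cases p)
    have i: "i < E" "(i, False) \<in> X" "(i, True) \<in> X" using True p by (auto simp: endpoints_def)
    have "(vertex (i, False) \<in> V1 \<and> vertex (i, True) \<in> V2) \<or> (vertex (i, False) \<in> V2 \<and> vertex (i, True) \<in> V1)"
      using i vertex_in by (intro e[rule_format]) auto
    then show ?thesis using V12 i p by (cases b) auto
  qed auto
  then have "?u \<in> even_funs (-1)"
    using in_X vertex_eq by (intro even_funsI vertex_funsI) auto
  moreover have "?u (0, False) \<noteq> 0" using E_pos by (simp add: endpoints_def)
  then have "?u \<noteq> 0" by (intro notI, drule_tac fun_cong[of _ _ "(0, False)"]) simp
  ultimately show "even_funs (-1) \<noteq> {0}" by blast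
next
  assume "even_funs (-1) \<noteq> {0}"
  moreover have "0 \<in> even_funs (-1)" using subspace_even_funs by (auto simp: fs.subspace_def)
  ultimately obtain \<phi> where phi: "\<phi> \<in> even_funs (-1)" "\<phi> \<noteq> 0" by blast
  have W: "\<phi> \<in> vertex_funs" and o: "\<And>p. \<phi> (opp p) = - \<phi> p"
    using even_funsD[OF phi(1)] by simp_all
  obtain p0 where p0: "\<phi> p0 \<noteq> 0" using phi(2) by (auto simp: fun_eq_iff)
  then have "p0 \<in> X" using vertex_funsD(1)[OF W] by blast
  \<comment> \<open>The modulus is constant, so a single nonzero value excludes zeros on all of
    \<open>X\<close>.\<close>
  then have nz: "\<phi> p \<noteq> 0" if "p \<in> X" for p
    using even_funs_minus_1[OF phi(1)] p0 that by (metis abs_eq_0)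
  \<comment> \<open>\<open>?V2\<close> is the plain complement, so the two classes partition
    \<open>V\<close> trivially; constancy on vertices makes it the class of negative values.\<close>
  let ?V1 = "{v\<in>V. \<forall>p\<in>v. \<phi> p > 0}" and ?V2 = "{v\<in>V. \<not> (\<forall>p\<in>v. \<phi> p > 0)}"
  have "\<forall>i<E. \<forall>v\<in>V. \<forall>w\<in>V. (i, False) \<in> v \<longrightarrow> (i, True) \<in> w \<longrightarrow>
            (v \<in> ?V1 \<and> w \<in> ?V2) \<or> (v \<in> ?V2 \<and> w \<in> ?V1)"
  proof (intro allI ballI impI)
    fix i v w assume a: "i < E" "v \<in> V" "w \<in> V" "(i, False) \<in> v" "(i, True) \<in> w"
    have v: "\<forall>p\<in>v. \<phi> p = \<phi> (i, False)" and w: "\<forall>p\<in>w. \<phi> p = \<phi> (i, True)"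
      using vertex_funsD(2)[OF W] a by blast+
    have "\<phi> (i, True) = - \<phi> (i, False)" using o[of "(i, False)"] by simp
    moreover have "\<phi> (i, False) \<noteq> 0" using nz a in_X by blast
    moreover have pv: "(\<forall>p\<in>v. \<phi> p > 0) \<longleftrightarrow> \<phi> (i, False) > 0" using v a(4) by metis
    moreover have pw: "(\<forall>p\<in>w. \<phi> p > 0) \<longleftrightarrow> \<phi> (i, True) > 0" using w a(5) by metis
    ultimately show "(v \<in> ?V1 \<and> w \<in> ?V2) \<or> (v \<in> ?V2 \<and> w \<in> ?V1)"
      using pv pw a by auto
  qed
  moreover have "?V1 \<union> ?V2 = V" "?V1 \<inter> ?V2 = {}" by auto
  ultimately show "bipartite E V"
    unfolding bipartite_def by (intro exI[of _ ?V1] exI[of _ ?V2] conjI)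
qed

lemma dim_even_funs_minus_1: "fs.dim (even_funs (-1)) = (if bipartite E V then 1 else 0)"
proof (cases "bipartite E V")
  case False
  then have "even_funs (-1) = {0}" using bipartite_iff by blast
  then show ?thesis
    using False fs.basis_card_eq_dim[of "{}" "{0}"] fs.independent_empty by simp
next
  case True
  moreover have "0 \<in> even_funs (-1)" using subspace_even_funs by (auto simp: fs.subspace_def)
  ultimately obtain u where u: "u \<in> even_funs (-1)" "u \<noteq> 0" using bipartite_iff by blast
  obtain c where c: "\<And>p. p \<in> X \<Longrightarrow> \<bar>u p\<bar> = c" by (rule even_funs_minus_1[OF u(1)]) blast
  have us: "u p = 0" if "p \<notin> X" for p using vertex_funsD(1)[OF even_funsD(1)[OF u(1)]] that by blast
  have c0: "c \<noteq> 0"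
  proof
    assume "c = 0"
    then have "u p = 0" for p using c us by (cases "p \<in> X") auto
    then show False using u(2) by auto
  qed
  have "even_funs (-1) \<subseteq> fs.span {u}"
  proof
    fix \<phi> assume phi: "\<phi> \<in> even_funs (-1)"
    \<comment> \<open>Two sign reversals cancel, so the product is constant; as \<open>u\<close> has
      constant square on \<open>X\<close>, this makes \<open>\<phi>\<close> a multiple of
      \<open>u\<close>.\<close>
    have "(\<lambda>p. \<phi> p * u p) \<in> even_funs 1"
    proof (intro even_funsI vertex_funsI)
      show "\<phi> p * u p = \<phi> q * u q" if "v \<in> V" "p \<in> v" "q \<in> v" for v p q
        using vertex_funsD(2)[OF even_funsD(1)[OF phi] that] vertex_funsD(2)[OF even_funsD(1)[OF u(1)] that] by simp
    qed (use us even_funsD(2)[OF phi] even_funsD(2)[OF u(1)] in auto)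
    then obtain d where d: "\<And>p. p \<in> X \<Longrightarrow> \<phi> p * u p = d" by (rule even_funs_1_constant) blast
    have "\<phi> p = d / c\<^sup>2 * u p" for p
    proof (cases "p \<in> X")
      case True
      then have "c\<^sup>2 = u p * u p" using c[OF True] by (metis power2_abs power2_eq_square)
      then show ?thesis using d[OF True] c0 by (auto simp: field_simps)
    next
      case False
      then show ?thesis using us vertex_funsD(1)[OF even_funsD(1)[OF phi]] by simp
    qed
    then have "\<phi> = scl (d / c\<^sup>2) u" by auto
    then show "\<phi> \<in> fs.span {u}" by (metis fs.span_base fs.span_scale insertI1)
  qed
  then show ?thesis
    using True u fs.basis_card_eq_dim[of "{u}" "even_funs (-1)"] by simp
qed

text \<open>One normalised vector per edge, proportional to 1 and \<open>- e\<close> at its two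
  ends; disjoint supports give orthogonality.\<close>

lemma dim_odd_funs:
  assumes e: "e = 1 \<or> e = -1"
  shows "fs.dim (odd_funs e) = E"
proof -
  define u where "u i = (\<lambda>p. if fst p = i then (if snd p then - e else 1) / sqrt 2 else 0)" for i :: nat
  have dot_u: "dot X f (u i) = (f (i, False) - e * f (i, True)) / sqrt 2" if "i < E" for f i
  proof -
    have "dot X f (u i) = (\<Sum>j<E. if j = i then (f (i, False) - e * f (i, True)) / sqrt 2 else 0)"
      unfolding dot_def sum_endpoints by (intro sum.cong) (auto simp: u_def field_simps)
    then show ?thesis using that by simp
  qed
  have on: "dot X (u i) (u j) = (if i = j then 1 else 0)" if "j < E" for i j
    using e by (auto simp: dot_u[OF that]) (auto simp: u_def field_simps)
  have inj: "inj_on u {..<E}" by (rule inj_onI) (metis lessThan_iff on zero_neq_one)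
  have "onb X (odd_funs e) (u ` {..<E})"
    unfolding onb_def
  proof (intro conjI ballI impI)
    show "orthonormal X (u ` {..<E})"
      using on inj by (auto simp: orthonormal_def inj_on_def)
    show "u ` {..<E} \<subseteq> odd_funs e"
    proof (intro image_subsetI odd_funsI)
      show "u i (opp p) = - e * u i p" if "i \<in> {..<E}" for i p using e by (auto simp: u_def)
    qed (auto simp: u_def endpoints_def)
    fix f assume f: "f \<in> odd_funs e" "\<forall>b\<in>u ` {..<E}. dot X f b = 0"
    have "f p = 0" for p
    proof (cases "p \<in> X")
      case True
      then have "fst p < E" by (simp add: endpoints_def)
      then have "f (fst p, False) = e * f (fst p, True)" using f(2) dot_u by force
      moreover have "f (fst p, True) = - e * f (fst p, False)"
        using odd_funsD(2)[OF f(1), of "(fst p, False)"] by simp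
      ultimately have "f (fst p, False) = 0" "f (fst p, True) = 0" using e by auto
      then show ?thesis by (cases p; cases "snd p") auto
    next
      case False
      then show ?thesis using odd_funsD(1)[OF f(1)] by blast
    qed
    then show "f = 0" by auto
  qed auto
  then have "fs.dim (odd_funs e) = card (u ` {..<E})" using onb_dim subspace_odd_funs by blast
  then show ?thesis using inj by (simp add: card_image)
qed

end

section \<open>Dimensions of even functions and flows, counted in a fixed eigenbasis\<close>

locale equilateral_graph_eigenbasis = equilateral_graph +
  fixes B :: "(endpoint \<Rightarrow> real) set" and \<mu> :: "(endpoint \<Rightarrow> real) \<Rightarrow> real"
  assumes B: "onb X vertex_funs B" and mu: "\<And>b. b \<in> B \<Longrightarrow> transition b = scl (\<mu> b) b"
begin

lemma finB: "finite B" and BW: "\<And>b. b \<in> B \<Longrightarrow> b \<in> vertex_funs"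
  and onB: "\<And>b c. b \<in> B \<Longrightarrow> c \<in> B \<Longrightarrow> dot X b c = (if b = c then 1 else 0)"
  and complB: "\<And>f. f \<in> vertex_funs \<Longrightarrow> (\<forall>b\<in>B. dot X f b = 0) \<Longrightarrow> f = 0"
  using B by (auto simp: onb_def orthonormal_def)

lemma mu_bound: "b \<in> B \<Longrightarrow> \<bar>\<mu> b\<bar> \<le> 1"
  using transition_eigenvalue_bound[OF BW mu, of b] onB[of b b] by force

lemma dim_transition_eigenspace:
  "fs.dim {\<phi>\<in>vertex_funs. transition \<phi> = scl m \<phi>} = card {b\<in>B. \<mu> b = m}"
proof (rule onb_dim)
  let ?F = "{\<phi>\<in>vertex_funs. transition \<phi> = scl m \<phi>}"
  show "fs.subspace ?F"
    using subspace_vertex_funs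
    by (auto simp: fs.subspace_def transition_add transition_scl) (auto simp: fun_eq_iff transition_def avg_def algebra_simps)
  show "onb X ?F {b\<in>B. \<mu> b = m}"
    unfolding onb_def
  proof (intro conjI ballI impI)
    show "orthonormal X {b\<in>B. \<mu> b = m}" using onB by (auto simp: orthonormal_def)
    fix f assume f: "f \<in> ?F" "\<forall>b\<in>{b\<in>B. \<mu> b = m}. dot X f b = 0"
    have "dot X f b = 0" if b: "b \<in> B" for b
    proof (cases "\<mu> b = m")
      case False
      \<comment> \<open>By symmetry, eigenvectors for different eigenvalues are orthogonal.\<close>
      have "m * dot X f b = \<mu> b * dot X f b"
        using transition_sym[of f b] f BW[OF b] mu[OF b] by simp
      then show ?thesis using False by simp
    qed (use f b in auto)
    then show "f = 0" using complB f by auto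
  qed (use finB BW mu in auto)
qed

lemma dim_even_funs:
  assumes "e = 1 \<or> e = -1"
  shows "fs.dim (even_funs e) = card {b\<in>B. \<mu> b = e}"
proof -
  have "even_funs e = {\<phi>\<in>vertex_funs. transition \<phi> = scl e \<phi>}"
    using transition_eq_sign_iff[OF _ assms] by (auto simp: even_funs_def)
  then show ?thesis using dim_transition_eigenspace by simp
qed

text \<open>The antisymmetrisations \<open>b - e (b \<circ> opp)\<close> of the eigenbasis are pairwise orthogonal, vanish
  exactly for \<open>\<mu> b = e\<close>, and their orthogonal complement in \<open>odd_funs e\<close> is \<open>flows e\<close>.\<close>
lemma dim_flows:
  assumes e: "e = 1 \<or> e = -1"
  shows "fs.dim (flows e) + card {b\<in>B. \<mu> b \<noteq> e} = E"
proof -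
  \<comment> \<open>\<open>2 * (1 - e * \<mu> b)\<close> is the squared norm of
    \<open>b - scl e (b \<circ> opp)\<close>; it is positive exactly when
    \<open>\<mu> b \<noteq> e\<close>.\<close>
  define q where "q b = scl (1 / sqrt (2 * (1 - e * \<mu> b))) (b - scl e (b \<circ> opp))" for b
  let ?B = "{b\<in>B. \<mu> b \<noteq> e}"
  have pos: "1 - e * \<mu> b > 0" if "b \<in> ?B" for b
    using mu_bound[of b] that e by auto
  have dot_opp_B: "dot X (b \<circ> opp) c = \<mu> b * dot X b c" if "b \<in> B" "c \<in> B" for b c
    using dot_avg[OF BW[OF that(2)], of "b \<circ> opp"] mu[OF that(1)] by (simp add: transition_def)
  have e2: "e * e = 1" using e by auto
  have on: "dot X (q b) (q c) = (if b = c then 1 else 0)" if b: "b \<in> ?B" and c: "c \<in> ?B" for b c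
  proof -
    have "dot X (b \<circ> opp) c = \<mu> b * dot X b c" "dot X b (c \<circ> opp) = \<mu> b * dot X b c"
      using dot_opp_B[of b c] b c by (auto simp flip: dot_opp)
    then have "dot X (b - scl e (b \<circ> opp)) (c - scl e (c \<circ> opp))
        = (1 + e * e) * dot X b c - e * (\<mu> b * dot X b c) - e * (\<mu> b * dot X b c)"
      by (simp add: algebra_simps)
    also have "\<dots> = 2 * (1 - e * \<mu> b) * dot X b c"
      unfolding e2 by (simp add: algebra_simps)
    finally have d: "dot X (b - scl e (b \<circ> opp)) (c - scl e (c \<circ> opp)) = 2 * (1 - e * \<mu> b) * dot X b c" .
    show ?thesis
      unfolding q_def dot_scl_left dot_scl_right d
      using onB[of b c] b c pos[OF b] by auto
  qed
  have inj: "inj_on q ?B"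
  proof (rule inj_onI, rule ccontr)
    fix b c assume "b \<in> ?B" "c \<in> ?B" "q b = q c" "b \<noteq> c"
    then show False using on[of b c] on[of c c] by simp
  qed
  have odd: "q ` ?B \<subseteq> odd_funs e"
  proof
    fix f assume "f \<in> q ` ?B"
    then obtain b where b: "b \<in> B" "f = q b" by auto
    show "f \<in> odd_funs e"
      unfolding b(2) using e vertex_funsD(1)[OF BW[OF b(1)]]
      by (intro odd_funsI) (auto simp: q_def algebra_simps)
  qed
  have "{\<psi>\<in>odd_funs e. \<forall>b\<in>q ` ?B. dot X \<psi> b = 0} = flows e"
  proof -
    have "(\<forall>b\<in>q ` ?B. dot X \<psi> b = 0) \<longleftrightarrow> avg \<psi> = 0" if psi: "\<psi> \<in> odd_funs e" for \<psi>
    proof -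
      \<comment> \<open>An odd \<open>\<psi>\<close> pairs equally with both parts of the
        antisymmetrisation.\<close>
      have half: "dot X \<psi> (b - scl e (b \<circ> opp)) = 2 * dot X \<psi> b" for b
      proof -
        have "dot X \<psi> (b \<circ> opp) = - e * dot X \<psi> b"
          using psi unfolding odd_funs_def by (metis (mono_tags, lifting) dot_opp dot_scl_left mem_Collect_eq)
        then show ?thesis using e by auto
      qed
      have "dot X \<psi> (q b) = 0 \<longleftrightarrow> dot X \<psi> b = 0" if "b \<in> ?B" for b
        unfolding q_def dot_scl_right half using pos[OF that] by simp
      then have "(\<forall>b\<in>q ` ?B. dot X \<psi> b = 0) \<longleftrightarrow> (\<forall>b\<in>?B. dot X \<psi> b = 0)"
        by blast
      also have "\<dots> \<longleftrightarrow> (\<forall>b\<in>B. dot X \<psi> b = 0)"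
      proof -
        \<comment> \<open>For \<open>\<mu> b = e\<close> the antisymmetrisation is 0, so
          \<open>half\<close> makes these basis vectors orthogonal to every odd
          \<open>\<psi>\<close>.\<close>
        have "dot X \<psi> b = 0" if "b \<in> B" "\<mu> b = e" for b
        proof -
          have "b \<circ> opp = scl e b"
            using transition_eq_sign_iff[OF BW[OF that(1)] e] mu[OF that(1)] that(2) by simp
          then have "b - scl e (b \<circ> opp) = 0" using e by (auto intro!: ext)
          then show ?thesis using half[of b] by simp
        qed
        then show ?thesis by blast
      qed
      also have "\<dots> \<longleftrightarrow> (\<forall>b\<in>B. dot X (avg \<psi>) b = 0)" using dot_avg BW by simp
      also have "\<dots> \<longleftrightarrow> avg \<psi> = 0" using complB[OF avg_in] by auto
      finally show ?thesis .
    qed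
    then show ?thesis by (auto simp: flows_def)
  qed
  moreover have "fs.dim {\<psi>\<in>odd_funs e. \<forall>b\<in>q ` ?B. dot X \<psi> b = 0} + card (q ` ?B) = fs.dim (odd_funs e)"
    using on inj odd finB
    by (intro dim_orthogonal_complement subspace_odd_funs)
      (auto simp: orthonormal_def inj_on_def odd_funs_def)
  ultimately show ?thesis using inj dim_odd_funs[OF e] by (simp add: card_image)
qed

text \<open>The resonant multiplicity, in additive form to avoid subtraction of naturals. The sum is
  orthogonal because a flow projects to 0; the cardinality in \<open>dim_flows\<close> splits into
  the eigenvalues inside (-1, 1) and those equal to \<open>- e\<close>.\<close>

lemma dim_even_plus_flows:
  assumes e: "e = 1 \<or> e = -1"
  shows "fs.dim {\<phi> + \<psi> | \<phi> \<psi>. \<phi> \<in> even_funs e \<and> \<psi> \<in> flows e} + card {b\<in>B. \<bar>\<mu> b\<bar> < 1} + fs.dim (even_funs (-e))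
    = E + fs.dim (even_funs e)"
proof -
  have "fs.dim {\<phi> + \<psi> | \<phi> \<psi>. \<phi> \<in> even_funs e \<and> \<psi> \<in> flows e} = fs.dim (even_funs e) + fs.dim (flows e)"
  proof (rule dim_orthogonal_sum[of X])
    fix \<phi> \<psi> assume "\<phi> \<in> even_funs e" "\<psi> \<in> flows e"
    then have "\<phi> \<in> vertex_funs" "avg \<psi> = 0" by (auto simp: even_funs_def flows_def)
    then show "dot X \<phi> \<psi> = 0" using dot_avg[of \<phi> \<psi>] dot_commute[of X \<phi> \<psi>] by simp
  next
    show "even_funs e \<subseteq> supp X" "flows e \<subseteq> supp X"
      by (auto simp: even_funs_def vertex_funs_def flows_def odd_funs_def)
  qed (simp_all add: subspace_even_funs subspace_flows)
  moreover have "{b\<in>B. \<mu> b \<noteq> e} = {b\<in>B. \<bar>\<mu> b\<bar> < 1} \<union> {b\<in>B. \<mu> b = -e}"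
    using mu_bound e by (auto simp: abs_less_iff) (smt (verit))+
  then have "card {b\<in>B. \<mu> b \<noteq> e} = card {b\<in>B. \<bar>\<mu> b\<bar> < 1} + card {b\<in>B. \<mu> b = -e}"
    using finB e by (auto intro!: card_Un_disjoint)
  moreover have "- e = 1 \<or> - e = -1" using e by auto
  ultimately show ?thesis
    using dim_flows[OF e] dim_even_funs[of "-e"] by simp
qed

end

section \<open>Eigenfunctions\<close>

lemma gs_dim_0: "gs.dim {0} = 0"
  using gs.basis_card_eq_dim[of "{}" "{0}"] gs.independent_empty by simp

text \<open>A derivative within \<open>S\<close> sees only values on \<open>S\<close>, so functions
  truncated outside the edges can be differentiated by their formula.\<close>

lemma field_derivative_transform:
  assumes "x \<in> S" "\<And>y. y \<in> S \<Longrightarrow> g y = f y" "(f has_field_derivative d) (at x within S)"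
  shows "(g has_field_derivative d) (at x within S)"
  using has_derivative_transform[of x S g f "(*) d"] assms unfolding has_field_derivative_def by simp

text \<open>Rotating the phase vector \<open>(s * f, g)\<close> back by the angle
  \<open>s * x\<close> gives two constants of motion, \<open>u\<close> and \<open>w\<close>; undoing
  the rotation recovers the solution.\<close>

lemma oscillator_solution:
  fixes s l :: real
  assumes s: "s \<noteq> 0"
    and f: "\<And>x. x \<in> {0..l} \<Longrightarrow> (f has_real_derivative g x) (at x within {0..l})"
    and g: "\<And>x. x \<in> {0..l} \<Longrightarrow> (g has_real_derivative - (s\<^sup>2) * f x) (at x within {0..l})"
    and x: "x \<in> {0..l}"
  shows "f x = f 0 * cos (s * x) + g 0 / s * sin (s * x)"
    and "g x = - s * f 0 * sin (s * x) + g 0 * cos (s * x)"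
proof -
  define u where "u y = s * f y * cos (s * y) - g y * sin (s * y)" for y
  define w where "w y = s * f y * sin (s * y) + g y * cos (s * y)" for y
  have "(u has_real_derivative 0) (at y within {0..l})" if "y \<in> {0..l}" for y
    unfolding u_def by (auto intro!: derivative_eq_intros f g that simp: algebra_simps power2_eq_square)
  then obtain a where a: "\<And>y. y \<in> {0..l} \<Longrightarrow> u y = a"
    using has_field_derivative_zero_constant[of "{0..l}" u] by auto
  have "(w has_real_derivative 0) (at y within {0..l})" if "y \<in> {0..l}" for y
    unfolding w_def by (auto intro!: derivative_eq_intros f g that simp: algebra_simps power2_eq_square)
  then obtain b where b: "\<And>y. y \<in> {0..l} \<Longrightarrow> w y = b"
    using has_field_derivative_zero_constant[of "{0..l}" w] by auto
  have 0: "0 \<in> {0..l}" using x by auto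
  have ux: "u x = s * f 0" using a[OF x] a[OF 0] by (simp add: u_def)
  have wx: "w x = g 0" using b[OF x] b[OF 0] by (simp add: w_def)
  have sc: "sin (s * x) * sin (s * x) = 1 - cos (s * x) * cos (s * x)"
    using sin_cos_squared_add[of "s * x"] by (simp add: power2_eq_square)
  have "s * f x = u x * cos (s * x) + w x * sin (s * x)"
    by (simp add: u_def w_def algebra_simps sc)
  then show "f x = f 0 * cos (s * x) + g 0 / s * sin (s * x)"
    using s unfolding ux wx by (simp add: field_simps)
  have "g x = w x * cos (s * x) - u x * sin (s * x)"
    by (simp add: u_def w_def algebra_simps sc)
  then show "g x = - s * f 0 * sin (s * x) + g 0 * cos (s * x)"
    unfolding ux wx by simp
qed

text \<open>Since \<open>(f g)' = g\<^sup>2 - \<lambda> f\<^sup>2 \<ge> 0\<close>, the boundary condition forces \<open>f g\<close> to be constant.\<close>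
lemma nonpositive_eigenfunction:
  fixes l lam :: real
  assumes l: "0 < l" and lam: "lam \<le> 0"
    and f: "\<And>x. x \<in> {0..l} \<Longrightarrow> (f has_real_derivative g x) (at x within {0..l})"
    and g: "\<And>x. x \<in> {0..l} \<Longrightarrow> (g has_real_derivative - lam * f x) (at x within {0..l})"
    and bd: "f l * g l \<le> f 0 * g 0" and x: "x \<in> {0..l}"
  shows "f x = f 0" "g x = 0" "lam * f x = 0"
proof -
  define w where "w y = f y * g y" for y
  define w' where "w' y = (g y)\<^sup>2 - lam * (f y)\<^sup>2" for y
  have w: "(w has_real_derivative w' y) (at y within {0..l})" if "y \<in> {0..l}" for y
    unfolding w_def w'_def
    by (auto intro!: derivative_eq_intros f g that simp: algebra_simps power2_eq_square)
  have w'_nonneg: "0 \<le> w' y" for y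
    using mult_nonpos_nonneg[OF lam zero_le_power2[of "f y"]] zero_le_power2[of "g y"]
    unfolding w'_def by linarith
  have mono: "w a \<le> w b" if "0 \<le> a" "a \<le> b" "b \<le> l" for a b
  proof (rule DERIV_nonneg_imp_increasing_open[OF that(2)])
    show "\<exists>y. (w has_real_derivative y) (at x) \<and> 0 \<le> y" if "a < x" "x < b" for x
      using w[of x] w'_nonneg[of x] at_within_Icc_at[of 0 x l] that \<open>0 \<le> a\<close> \<open>b \<le> l\<close> by auto
    have "continuous_on {0..l} w" using w by (meson DERIV_continuous_on)
    then show "continuous_on {a..b} w" using that by (auto intro: continuous_on_subset)
  qed
  \<comment> \<open>Monotonicity gives \<open>w 0 \<le> w y \<le> w l\<close>, and \<open>bd\<close>
    closes the circle.\<close>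
  have const: "w y = w 0" if "y \<in> {0..l}" for y
    using mono[of 0 y] mono[of y l] bd that by (auto simp: w_def)
  have w'0: "w' y = 0" if y: "y \<in> {0..l}" for y
  proof -
    have "((\<lambda>_. w 0) has_real_derivative w' y) (at y within {0..l})"
      by (rule field_derivative_transform[OF y _ w[OF y]]) (rule const[symmetric])
    then show ?thesis
      using l y vector_derivative_unique_within_closed_interval[of 0 l y "\<lambda>_. w 0" "w' y" 0]
      by (simp add: has_real_derivative_iff_has_vector_derivative)
  qed
  \<comment> \<open>Both summands of \<open>w'\<close> are nonnegative, so each vanishes.\<close>
  have 0: "(g y)\<^sup>2 = 0 \<and> - lam * (f y)\<^sup>2 = 0" if "y \<in> {0..l}" for y
  proof -
    have "lam * (f y)\<^sup>2 \<le> 0" by (rule mult_nonpos_nonneg[OF lam zero_le_power2])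
    moreover have "(g y)\<^sup>2 - lam * (f y)\<^sup>2 = 0" using w'0[OF that] by (simp add: w'_def)
    moreover have "0 \<le> (g y)\<^sup>2" by simp
    ultimately show ?thesis by linarith
  qed
  show "g x = 0" "lam * f x = 0" using 0[OF x] by auto
  have "(f has_real_derivative 0) (at y within {0..l})" if "y \<in> {0..l}" for y
    using f[OF that] 0[OF that] by simp
  then show "f x = f 0"
    using has_field_derivative_zero_constant[of "{0..l}" f] x l by force
qed

lemma linear_fscaleI:
  assumes "\<And>f g. h (f + g) = h f + h g" "\<And>c f. h (fscale c f) = scl c (h f)"
  shows "Vector_Spaces.linear fscale scl h"
  by unfold_locales (auto simp: assms)

lemma edge_eigen_add:
  assumes "edge_eigen E L lam f g" "edge_eigen E L lam f' g'"
  shows "edge_eigen E L lam (f + f') (g + g')"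
  using assms unfolding edge_eigen_def plus_fun_def
  by (auto intro!: derivative_eq_intros simp: algebra_simps)

lemma edge_eigen_fscale:
  assumes "edge_eigen E L lam f g"
  shows "edge_eigen E L lam (fscale c f) (fscale c g)"
  using assms unfolding edge_eigen_def fscale_def
  by (auto intro!: derivative_eq_intros simp: algebra_simps)

lemma edge_eigen_0: "edge_eigen E L lam 0 0"
  unfolding edge_eigen_def zero_fun_def by (auto intro!: derivative_eq_intros)

lemma endval_simps [simp]: "endval L 0 p = 0" "endval L (f + f') p = endval L f p + endval L f' p"
  "endval L (fscale c f) p = c * endval L f p"
  by (simp_all add: endval_def)

lemma endder_simps [simp]: "endder L 0 p = 0" "endder L (f + f') p = endder L f p + endder L f' p"
  "endder L (fscale c f) p = c * endder L f p"
  by (simp_all add: endder_def)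

lemma subspace_st_eigenspace: "gs.subspace (st_eigenspace E L V lam)"
proof (rule gs.subspaceI)
  show "0 \<in> st_eigenspace E L V lam"
    unfolding st_eigenspace_def by (auto intro!: exI[of _ 0] edge_eigen_0)
next
  fix f f' assume "f \<in> st_eigenspace E L V lam" "f' \<in> st_eigenspace E L V lam"
  then obtain g g' where e: "edge_eigen E L lam f g" "edge_eigen E L lam f' g'"
    and v: "\<forall>v\<in>V. (\<forall>p\<in>v. \<forall>q\<in>v. endval L f p = endval L f q) \<and> (\<Sum>p\<in>v. endder L g p) = 0"
      "\<forall>v\<in>V. (\<forall>p\<in>v. \<forall>q\<in>v. endval L f' p = endval L f' q) \<and> (\<Sum>p\<in>v. endder L g' p) = 0"
    unfolding st_eigenspace_def by blast
  have a: "endval L (f + f') p = endval L (f + f') q" if "v \<in> V" "p \<in> v" "q \<in> v" for v p q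
  proof -
    have "endval L f p = endval L f q" "endval L f' p = endval L f' q" using v that by blast+
    then show ?thesis by simp
  qed
  have b: "(\<Sum>p\<in>v. endder L (g + g') p) = 0" if "v \<in> V" for v
    using v that by (simp add: sum.distrib)
  show "f + f' \<in> st_eigenspace E L V lam" unfolding st_eigenspace_def
    by (intro CollectI exI[of _ "g + g'"] conjI ballI edge_eigen_add[OF e]) (rule a b; assumption)+
next
  fix c f assume "f \<in> st_eigenspace E L V lam"
  then obtain g where e: "edge_eigen E L lam f g"
    and v: "\<forall>v\<in>V. (\<forall>p\<in>v. \<forall>q\<in>v. endval L f p = endval L f q) \<and> (\<Sum>p\<in>v. endder L g p) = 0"
    unfolding st_eigenspace_def by blast
  have a: "endval L (fscale c f) p = endval L (fscale c f) q" if "v \<in> V" "p \<in> v" "q \<in> v" for v p q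
  proof -
    have "endval L f p = endval L f q" using v that by blast
    then show ?thesis by simp
  qed
  have b: "(\<Sum>p\<in>v. endder L (fscale c g) p) = 0" if "v \<in> V" for v
    using v that by (simp flip: sum_distrib_left)
  show "fscale c f \<in> st_eigenspace E L V lam" unfolding st_eigenspace_def
    by (intro CollectI exI[of _ "fscale c g"] conjI ballI edge_eigen_fscale[OF e]) (rule a b; assumption)+
qed

lemma subspace_D_eigenspace: "gs.subspace (D_eigenspace E L lam)"
proof (rule gs.subspaceI)
  show "0 \<in> D_eigenspace E L lam"
    unfolding D_eigenspace_def by (auto intro!: exI[of _ 0] edge_eigen_0)
next
  fix f f' assume "f \<in> D_eigenspace E L lam" "f' \<in> D_eigenspace E L lam"
  then show "f + f' \<in> D_eigenspace E L lam"
    unfolding D_eigenspace_def by (auto intro: edge_eigen_add)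
next
  fix c f assume "f \<in> D_eigenspace E L lam"
  then show "fscale c f \<in> D_eigenspace E L lam"
    unfolding D_eigenspace_def by (auto intro: edge_eigen_fscale)
qed

section \<open>Boundary values, and eigenvalues at most 0\<close>

context equilateral_graph
begin

definition bdvals :: "(nat \<Rightarrow> real \<Rightarrow> real) \<Rightarrow> endpoint \<Rightarrow> real" where
  "bdvals f p = (if p \<in> X then endval L f p else 0)"

lemma linear_bdvals: "Vector_Spaces.linear fscale scl bdvals"
  by (rule linear_fscaleI) (auto simp: bdvals_def fun_eq_iff)

lemma endval_eq: "i < E \<Longrightarrow> endval L f (i, False) = f i 0" "i < E \<Longrightarrow> endval L f (i, True) = f i l"
  by (simp_all add: endval_def pos_def L_eq)

lemma endder_eq: "i < E \<Longrightarrow> endder L g (i, False) = g i 0" "i < E \<Longrightarrow> endder L g (i, True) = - g i l"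
  by (simp_all add: endder_def L_eq)

lemma bdvals_in_vertex_funs_iff:
  "bdvals f \<in> vertex_funs \<longleftrightarrow> (\<forall>v\<in>V. \<forall>p\<in>v. \<forall>q\<in>v. endval L f p = endval L f q)"
  (is "?l \<longleftrightarrow> ?r")
proof
  assume t: ?l
  show ?r
  proof (intro ballI)
    fix v p q assume v: "v \<in> V" "p \<in> v" "q \<in> v"
    then show "endval L f p = endval L f q"
      using vertex_funsD(2)[OF t v] in_X by (simp add: bdvals_def)
  qed
next
  assume r: ?r
  show ?l
  proof (rule vertex_funsI)
    fix v p q assume v: "v \<in> V" "p \<in> v" "q \<in> v"
    then have "endval L f p = endval L f q" using r by blast
    then show "bdvals f p = bdvals f q" using v in_X by (simp add: bdvals_def)
  qed (simp add: bdvals_def)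
qed

lemma edge_eigenD:
  assumes "edge_eigen E L lam f g"
  shows "i < E \<Longrightarrow> x \<in> {0..l} \<Longrightarrow> (f i has_real_derivative g i x) (at x within {0..l})"
    and "i < E \<Longrightarrow> x \<in> {0..l} \<Longrightarrow> (g i has_real_derivative - lam * f i x) (at x within {0..l})"
    and "\<not> (i < E \<and> x \<in> {0..l}) \<Longrightarrow> f i x = 0"
proof -
  show "f i x = 0" if "\<not> (i < E \<and> x \<in> {0..l})"
  proof (cases "i < E")
    case True
    then have "x \<notin> {0..L i}" using that L_eq by simp
    then show ?thesis using assms unfolding edge_eigen_def by blast
  next
    case False
    then show ?thesis using assms unfolding edge_eigen_def by auto
  qed
qed (use assms L_eq in \<open>auto simp: edge_eigen_def\<close>)

text \<open>Green's formula: continuity and Kirchhoff make the boundary terms of \<open>f\<close>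
  times \<open>g\<close> sum to 0 over the graph. Edge by edge their difference is nonnegative,
  hence 0, so \<open>nonpositive_eigenfunction\<close> applies to each edge.\<close>

lemma st_nonpositive:
  assumes "f \<in> st_eigenspace E L V lam" "lam \<le> 0" "i < E" "x \<in> {0..l}"
  shows "f i x = f i 0" "lam * f i x = 0" "bdvals f \<in> vertex_funs" "f i l = f i 0"
proof -
  obtain g where e: "edge_eigen E L lam f g"
    and v: "\<forall>v\<in>V. (\<forall>p\<in>v. \<forall>q\<in>v. endval L f p = endval L f q) \<and> (\<Sum>p\<in>v. endder L g p) = 0"
    using assms(1) unfolding st_eigenspace_def by blast
  show t: "bdvals f \<in> vertex_funs" using v bdvals_in_vertex_funs_iff by blast
  define w where "w j = f j l * g j l - f j 0 * g j 0" for j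
  have "avg (endder L g) = 0" using v avg_eq_0_iff by blast
  then have "dot X (endder L g) (bdvals f) = 0" using dot_avg[OF t, of "endder L g"] by simp
  moreover have "dot X (endder L g) (bdvals f) = (\<Sum>j<E. - w j)"
    unfolding dot_def sum_endpoints
    by (intro sum.cong) (auto simp: bdvals_def endval_eq endder_eq endpoints_def w_def)
  ultimately have sum0: "(\<Sum>j<E. w j) = 0" by (simp add: sum_negf)
  \<comment> \<open>A negative difference would itself satisfy the boundary hypothesis, forcing
    \<open>g = 0\<close> on the edge and hence difference 0.\<close>
  have nonneg: "0 \<le> w j" if "j < E" for j
  proof (rule ccontr)
    assume "\<not> 0 \<le> w j"
    then have w: "f j l * g j l \<le> f j 0 * g j 0" "w j < 0" by (auto simp: w_def)
    have "g j y = 0" if "y \<in> {0..l}" for y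
      by (rule nonpositive_eigenfunction(2)[OF l_pos assms(2) edge_eigenD(1)[OF e \<open>j < E\<close>]
            edge_eigenD(2)[OF e \<open>j < E\<close>] w(1) that])
    then show False using w(2) l_pos by (simp add: w_def)
  qed
  then have "\<forall>j\<in>{..<E}. w j = 0" using sum0 by (subst (asm) sum_nonneg_eq_0_iff) auto
  then have "w i = 0" using assms(3) by simp
  then have w: "f i l * g i l \<le> f i 0 * g i 0" by (simp add: w_def)
  note ne = nonpositive_eigenfunction[OF l_pos assms(2) edge_eigenD(1)[OF e assms(3)]
            edge_eigenD(2)[OF e assms(3)] w]
  show "f i x = f i 0" "lam * f i x = 0" "f i l = f i 0"
    using ne(1,3)[OF _ _ assms(4)] ne(1)[of l] l_pos by auto
qed

lemma mult_st_negative: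
  assumes "lam < 0"
  shows "multiplicity_of (st_eigenspace E L V lam) = 0"
proof -
  have "f = 0" if f: "f \<in> st_eigenspace E L V lam" for f
  proof (intro ext)
    fix i x
    obtain g where e: "edge_eigen E L lam f g" using f unfolding st_eigenspace_def by blast
    show "f i x = 0 i x"
      using st_nonpositive(2)[OF f, of i x] edge_eigenD(3)[OF e, of i x] assms by auto
  qed
  moreover have "0 \<in> st_eigenspace E L V lam" using subspace_st_eigenspace gs.subspace_0 by blast
  ultimately have "st_eigenspace E L V lam = {0}" by blast
  then show ?thesis by (simp add: multiplicity_of_def gs_dim_0)
qed

lemma mult_D_nonpositive:
  assumes "lam \<le> 0"
  shows "multiplicity_of (D_eigenspace E L lam) = 0"
proof -
  have "f = 0" if f: "f \<in> D_eigenspace E L lam" for f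
  proof (intro ext)
    fix i x
    obtain g where e: "edge_eigen E L lam f g" and z: "\<forall>p\<in>X. endval L f p = 0"
      using f unfolding D_eigenspace_def by blast
    show "f i x = 0 i x"
    proof (cases "i < E \<and> x \<in> {0..l}")
      case True
      then have "f i 0 = 0" "f i l = 0"
        using z endval_eq[of i f] by (auto simp: endpoints_def)
      then show ?thesis
        using nonpositive_eigenfunction(1)[OF l_pos assms edge_eigenD(1)[OF e] edge_eigenD(2)[OF e], of i x] True by simp
    qed (use edge_eigenD(3)[OF e] in auto)
  qed
  moreover have "0 \<in> D_eigenspace E L lam" using subspace_D_eigenspace gs.subspace_0 by blast
  ultimately have "D_eigenspace E L lam = {0}" by blast
  then show ?thesis by (simp add: multiplicity_of_def gs_dim_0)
qed

text \<open>Eigenfunctions for 0 are constant on every edge, so \<open>bdvals\<close> identifies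
  them with \<open>even_funs 1\<close>.\<close>

lemma mult_st_0: "multiplicity_of (st_eigenspace E L V 0) = 1"
proof -
  let ?S = "st_eigenspace E L V 0"
  have const: "f i x = (if i < E \<and> x \<in> {0..l} then bdvals f (i, False) else 0)" if f: "f \<in> ?S" for f i x
  proof -
    obtain g where e: "edge_eigen E L 0 f g" using f unfolding st_eigenspace_def by blast
    show ?thesis
      using st_nonpositive(1)[OF f, of i x] edge_eigenD(3)[OF e, of i x]
      by (auto simp: bdvals_def endval_eq endpoints_def)
  qed
  have inj: "inj_on bdvals ?S"
    by (rule inj_onI, intro ext) (simp add: const)
  have "bdvals ` ?S = even_funs 1"
  proof
    show "bdvals ` ?S \<subseteq> even_funs 1"
    proof (intro image_subsetI even_funsI)
      fix f and p :: endpoint assume f: "f \<in> ?S"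
      show "bdvals f \<in> vertex_funs" using st_nonpositive(3)[OF f, of 0 0] E_pos l_pos by simp
      obtain i b where p: "p = (i, b)" by (cases p)
      show "bdvals f (opp p) = 1 * bdvals f p"
        using st_nonpositive(4)[OF f, of i 0] l_pos unfolding p
        by (cases b) (auto simp: bdvals_def endval_eq endpoints_def)
    qed
    show "even_funs 1 \<subseteq> bdvals ` ?S"
    proof
      fix \<phi> assume phi: "\<phi> \<in> even_funs 1"
      define f where "f i x = (if i < E \<and> x \<in> {0..l} then \<phi> (i, False) else 0)" for i :: nat and x :: real
      have "edge_eigen E L 0 f 0"
        unfolding edge_eigen_def
      proof (intro conjI allI ballI impI)
        fix i x assume i: "i < E" "x \<in> {0..L i}"
        show "(f i has_real_derivative 0 i x) (at x within {0..L i})"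
          by (rule field_derivative_transform[of x _ _ "\<lambda>_. \<phi> (i, False)"])
             (use i L_eq in \<open>auto simp: f_def\<close>)
        show "(0 i has_real_derivative - 0 * f i x) (at x within {0..L i})"
          by (simp add: zero_fun_def)
      qed (auto simp: f_def L_eq)
      moreover have t: "bdvals f = \<phi>"
      proof
        fix p :: endpoint obtain i b where p: "p = (i, b)" by (cases p)
        show "bdvals f p = \<phi> p"
          using even_funsD(2)[OF phi, of "(i, False)"] vertex_funsD(1)[OF even_funsD(1)[OF phi], of p] l_pos
          unfolding p by (cases b) (auto simp: bdvals_def endval_eq endpoints_def f_def)
      qed
      moreover have "\<forall>v\<in>V. \<forall>p\<in>v. \<forall>q\<in>v. endval L f p = endval L f q"
        by (rule iffD1[OF bdvals_in_vertex_funs_iff]) (simp add: t even_funsD(1)[OF phi])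
      moreover have "(\<Sum>p\<in>v. endder L 0 p) = 0" for v by simp
      ultimately have "f \<in> ?S" unfolding st_eigenspace_def by blast
      then show "\<phi> \<in> bdvals ` ?S" using t by blast
    qed
  qed
  then show ?thesis
    using dim_image_inj[OF linear_bdvals subspace_st_eigenspace inj] dim_even_funs_1
    by (simp add: multiplicity_of_def)
qed


section \<open>Positive eigenvalues in terms of cosine and sine amplitudes\<close>

definition osc :: "real \<Rightarrow> (nat \<Rightarrow> real) \<Rightarrow> (nat \<Rightarrow> real) \<Rightarrow> nat \<Rightarrow> real \<Rightarrow> real" where
  "osc s a b i x = (if i < E \<and> x \<in> {0..l} then a i * cos (s * x) + b i * sin (s * x) else 0)"

definition osc_val :: "real \<Rightarrow> (nat \<Rightarrow> real) \<Rightarrow> (nat \<Rightarrow> real) \<Rightarrow> endpoint \<Rightarrow> real" where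
  "osc_val s a b p = (if p \<in> X then
     (if snd p then a (fst p) * cos (s * l) + b (fst p) * sin (s * l) else a (fst p)) else 0)"

text \<open>The end derivatives \<open>endder\<close> divided by \<open>s\<close>; the positive
  factor drops out of Kirchhoff's condition.\<close>

definition osc_der :: "real \<Rightarrow> (nat \<Rightarrow> real) \<Rightarrow> (nat \<Rightarrow> real) \<Rightarrow> endpoint \<Rightarrow> real" where
  "osc_der s a b p = (if p \<in> X then
     (if snd p then a (fst p) * sin (s * l) - b (fst p) * cos (s * l) else b (fst p)) else 0)"

lemma in_endpoints_iff: "p \<in> X \<longleftrightarrow> fst p < E"
  by (simp add: endpoints_def)

lemma bdvals_osc: "bdvals (osc s a b) = osc_val s a b"
proof
  fix p :: endpoint
  show "bdvals (osc s a b) p = osc_val s a b p"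
    using l_pos endval_eq[of "fst p" "osc s a b"]
    by (cases p; cases "snd p") (auto simp: bdvals_def osc_val_def in_endpoints_iff osc_def)
qed

lemma edge_eigen_osc:
  "edge_eigen E L (s\<^sup>2) (osc s a b) (\<lambda>i x. s * (b i * cos (s * x) - a i * sin (s * x)))"
  unfolding edge_eigen_def
proof (intro conjI allI ballI impI)
  fix i x assume i: "i < E" "x \<in> {0..L i}"
  show "(osc s a b i has_real_derivative s * (b i * cos (s * x) - a i * sin (s * x))) (at x within {0..L i})"
    by (rule field_derivative_transform[of x _ _ "\<lambda>x. a i * cos (s * x) + b i * sin (s * x)"])
      (use i L_eq in \<open>auto simp: osc_def algebra_simps intro!: derivative_eq_intros\<close>)
  show "((\<lambda>x. s * (b i * cos (s * x) - a i * sin (s * x))) has_real_derivative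
      - (s\<^sup>2) * osc s a b i x) (at x within {0..L i})"
    using i L_eq by (auto simp: osc_def algebra_simps power2_eq_square intro!: derivative_eq_intros)
qed (auto simp: osc_def L_eq)

lemma edge_eigen_oscD:
  assumes e: "edge_eigen E L (s\<^sup>2) f g" and s: "0 < s"
  shows "f = osc s (\<lambda>i. f i 0) (\<lambda>i. g i 0 / s)"
    and "p \<in> X \<Longrightarrow> endder L g p = s * osc_der s (\<lambda>i. f i 0) (\<lambda>i. g i 0 / s) p"
proof -
  have sol: "f i x = f i 0 * cos (s * x) + g i 0 / s * sin (s * x)"
    "g i x = - s * f i 0 * sin (s * x) + g i 0 * cos (s * x)" if "i < E" "x \<in> {0..l}" for i x
    using oscillator_solution[of s l "f i" "g i" x] edge_eigenD(1,2)[OF e that(1)] s that by auto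
  show "f = osc s (\<lambda>i. f i 0) (\<lambda>i. g i 0 / s)"
  proof (intro ext)
    fix i x
    show "f i x = osc s (\<lambda>i. f i 0) (\<lambda>i. g i 0 / s) i x"
      using edge_eigenD(3)[OF e, of i x] sol(1)[of i x] unfolding osc_def by presburger
  qed
  assume p: "p \<in> X"
  obtain i b where ib: "p = (i, b)" by (cases p)
  then have i: "i < E" using p by (simp add: endpoints_def)
  show "endder L g p = s * osc_der s (\<lambda>i. f i 0) (\<lambda>i. g i 0 / s) p"
    using endder_eq[OF i, of g] sol(2)[OF i, of l] l_pos s p unfolding ib osc_der_def
    by (cases b) (auto simp: right_diff_distrib)
qed

lemma endder_osc:
  assumes "p \<in> X"
  shows "endder L (\<lambda>i x. s * (b i * cos (s * x) - a i * sin (s * x))) p = s * osc_der s a b p"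
  using assms by (auto simp: endder_def osc_der_def endpoints_def L_eq algebra_simps)

lemma kirchhoff_iff:
  assumes s: "0 < s" and d: "\<And>p. p \<in> X \<Longrightarrow> endder L g p = s * \<delta> p"
  shows "(\<forall>v\<in>V. (\<Sum>p\<in>v. endder L g p) = 0) \<longleftrightarrow> avg \<delta> = 0"
proof -
  have "(\<Sum>p\<in>v. endder L g p) = s * (\<Sum>p\<in>v. \<delta> p)" if "v \<in> V" for v
    unfolding sum_distrib_left using that by (intro sum.cong refl d in_X)
  then show ?thesis using s by (simp add: avg_eq_0_iff)
qed

lemma st_eigenspace_iff:
  assumes s: "0 < s"
  shows "f \<in> st_eigenspace E L V (s\<^sup>2) \<longleftrightarrow>
    (\<exists>a b. f = osc s a b \<and> osc_val s a b \<in> vertex_funs \<and> avg (osc_der s a b) = 0)"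
proof
  assume "f \<in> st_eigenspace E L V (s\<^sup>2)"
  then obtain g where e: "edge_eigen E L (s\<^sup>2) f g"
    and v: "\<forall>v\<in>V. \<forall>p\<in>v. \<forall>q\<in>v. endval L f p = endval L f q" "\<forall>v\<in>V. (\<Sum>p\<in>v. endder L g p) = 0"
    unfolding st_eigenspace_def by blast
  let ?a = "\<lambda>i. f i 0" and ?b = "\<lambda>i. g i 0 / s"
  have f: "f = osc s ?a ?b" by (rule edge_eigen_oscD(1)[OF e s])
  have "bdvals f \<in> vertex_funs" using v(1) bdvals_in_vertex_funs_iff by blast
  then have "osc_val s ?a ?b \<in> vertex_funs" using bdvals_osc[of s ?a ?b] f by simp
  moreover have "avg (osc_der s ?a ?b) = 0"
    using v(2) kirchhoff_iff[OF s edge_eigen_oscD(2)[OF e s]] by blast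
  ultimately show "\<exists>a b. f = osc s a b \<and> osc_val s a b \<in> vertex_funs \<and> avg (osc_der s a b) = 0"
    using f by blast
next
  assume "\<exists>a b. f = osc s a b \<and> osc_val s a b \<in> vertex_funs \<and> avg (osc_der s a b) = 0"
  then obtain a b where f: "f = osc s a b" and v: "osc_val s a b \<in> vertex_funs" "avg (osc_der s a b) = 0"
    by blast
  let ?g = "\<lambda>i x. s * (b i * cos (s * x) - a i * sin (s * x))"
  have "edge_eigen E L (s\<^sup>2) f ?g" unfolding f by (rule edge_eigen_osc)
  moreover have "\<forall>v\<in>V. \<forall>p\<in>v. \<forall>q\<in>v. endval L f p = endval L f q"
    by (rule iffD1[OF bdvals_in_vertex_funs_iff]) (simp add: f bdvals_osc v(1))
  moreover have "\<forall>v\<in>V. (\<Sum>p\<in>v. endder L ?g p) = 0"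
    by (rule iffD2[OF kirchhoff_iff[OF s endder_osc] v(2)])
  ultimately show "f \<in> st_eigenspace E L V (s\<^sup>2)" unfolding st_eigenspace_def by blast
qed

lemma D_eigenspace_iff:
  assumes s: "0 < s"
  shows "f \<in> D_eigenspace E L (s\<^sup>2) \<longleftrightarrow> (\<exists>a b. f = osc s a b \<and> osc_val s a b = 0)"
proof
  assume "f \<in> D_eigenspace E L (s\<^sup>2)"
  then obtain g where e: "edge_eigen E L (s\<^sup>2) f g" and v: "\<forall>p\<in>X. endval L f p = 0"
    unfolding D_eigenspace_def by blast
  let ?a = "\<lambda>i. f i 0" and ?b = "\<lambda>i. g i 0 / s"
  have f: "f = osc s ?a ?b" by (rule edge_eigen_oscD(1)[OF e s])
  have "bdvals f = 0" using v by (intro ext) (simp add: bdvals_def)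
  then show "\<exists>a b. f = osc s a b \<and> osc_val s a b = 0" using f bdvals_osc[of s ?a ?b] by metis
next
  assume "\<exists>a b. f = osc s a b \<and> osc_val s a b = 0"
  then obtain a b where f: "f = osc s a b" and v: "osc_val s a b = 0" by blast
  have "endval L f p = 0" if "p \<in> X" for p
    using fun_cong[OF v, of p] that fun_cong[OF bdvals_osc[of s a b], of p] unfolding f
    by (simp add: bdvals_def)
  then show "f \<in> D_eigenspace E L (s\<^sup>2)"
    using edge_eigen_osc[of s a b] unfolding D_eigenspace_def f by blast
qed

lemma osc_cong:
  assumes "\<And>i. i < E \<Longrightarrow> a i = a' i" "\<And>i. i < E \<Longrightarrow> b i = b' i"
  shows "osc s a b = osc s a' b'"
  by (intro ext) (simp add: osc_def assms)

lemma osc_val_simps: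
  "i < E \<Longrightarrow> osc_val s a b (i, False) = a i"
  "i < E \<Longrightarrow> osc_val s a b (i, True) = a i * cos (s * l) + b i * sin (s * l)"
  by (simp_all add: osc_val_def endpoints_def)

lemma osc_val_inj:
  assumes "sin (s * l) \<noteq> 0" "osc_val s a b = osc_val s a' b'"
  shows "osc s a b = osc s a' b'"
proof (rule osc_cong)
  fix i assume i: "i < E"
  show a: "a i = a' i" using fun_cong[OF assms(2), of "(i, False)"] osc_val_simps(1)[OF i] by simp
  have "a i * cos (s * l) + b i * sin (s * l) = a' i * cos (s * l) + b' i * sin (s * l)"
    using fun_cong[OF assms(2), of "(i, True)"] osc_val_simps(2)[OF i] by simp
  then show "b i = b' i" using assms(1) a by simp
qed

lemma mult_D_generic:
  assumes s: "0 < s" "sin (s * l) \<noteq> 0"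
  shows "multiplicity_of (D_eigenspace E L (s\<^sup>2)) = 0"
proof -
  have "f = 0" if "f \<in> D_eigenspace E L (s\<^sup>2)" for f
  proof -
    obtain a b where f: "f = osc s a b" and v: "osc_val s a b = 0"
      using \<open>f \<in> _\<close> D_eigenspace_iff[OF s(1)] by blast
    have "osc_val s (\<lambda>_. 0) (\<lambda>_. 0) = 0" by (intro ext) (simp add: osc_val_def)
    then have "f = osc s (\<lambda>_. 0) (\<lambda>_. 0)" unfolding f using v by (intro osc_val_inj[OF s(2)]) simp
    then show ?thesis by (auto simp: osc_def intro!: ext)
  qed
  moreover have "0 \<in> D_eigenspace E L (s\<^sup>2)" using subspace_D_eigenspace gs.subspace_0 by blast
  ultimately have "D_eigenspace E L (s\<^sup>2) = {0}" by blast
  then show ?thesis by (simp add: multiplicity_of_def gs_dim_0)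
qed

text \<open>The Dirichlet-to-Neumann relation of an edge, multiplied by \<open>sin (s * l)\<close>
  to avoid division. Averaged at the vertices, it turns Kirchhoff's condition into the eigenvalue
  equation of the walk.\<close>

lemma sin_osc_der:
  "scl (sin (s * l)) (osc_der s a b) = (osc_val s a b \<circ> opp) - scl (cos (s * l)) (osc_val s a b)"
proof
  fix p :: endpoint
  define c d where "c = cos (s * l)" and "d = sin (s * l)"
  have "d * d = 1 - c * c"
    unfolding c_def d_def using sin_cos_squared_add[of "s * l"] by (simp add: power2_eq_square)
  then have sc: "c * (c * t) + d * (d * t) = t" for t
    by (simp add: left_diff_distrib flip: mult.assoc)
  have val: "osc_val s a b q = (if q \<in> X then
      (if snd q then a (fst q) * c + b (fst q) * d else a (fst q)) else 0)" for q
    by (simp add: osc_val_def c_def d_def)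
  have der: "osc_der s a b q = (if q \<in> X then
      (if snd q then a (fst q) * d - b (fst q) * c else b (fst q)) else 0)" for q
    by (simp add: osc_der_def c_def d_def)
  show "scl (sin (s * l)) (osc_der s a b) p = ((osc_val s a b \<circ> opp) - scl (cos (s * l)) (osc_val s a b)) p"
    unfolding c_def[symmetric] d_def[symmetric]
    by (cases "snd p") (auto simp: val der algebra_simps sc)
qed

lemma avg_diff: "avg (\<phi> - \<psi>) = avg \<phi> - avg \<psi>"
  by (intro ext) (simp add: avg_def sum_subtractf diff_divide_distrib)

lemma avg_scl: "avg (scl c \<phi>) = scl c (avg \<phi>)"
  by (intro ext) (simp add: avg_def flip: sum_distrib_left)

lemma avg_vertex_funs:
  assumes "\<phi> \<in> vertex_funs"
  shows "avg \<phi> = \<phi>"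
proof
  fix p
  show "avg \<phi> p = \<phi> p"
  proof (cases "p \<in> X")
    case True
    have "(\<Sum>q\<in>vertex p. \<phi> q) = (\<Sum>q\<in>vertex p. \<phi> p)"
      by (intro sum.cong refl vertex_funs_vertex[OF assms True])
    then show ?thesis using card_vertex[OF vertex_in(1)[OF True]] True by (simp add: avg_def)
  qed (simp add: avg_def vertex_funsD(1)[OF assms])
qed

lemma bdvals_st_eigenspace:
  assumes s: "0 < s" "sin (s * l) \<noteq> 0"
  shows "bdvals ` st_eigenspace E L V (s\<^sup>2) = {\<phi>\<in>vertex_funs. transition \<phi> = scl (cos (s * l)) \<phi>}"
    and "inj_on bdvals (st_eigenspace E L V (s\<^sup>2))"
proof -
  have key: "avg (osc_der s a b) = 0 \<longleftrightarrow> transition (osc_val s a b) = scl (cos (s * l)) (osc_val s a b)"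
    if "osc_val s a b \<in> vertex_funs" for a b
  proof -
    \<comment> \<open>Averaging \<open>sin_osc_der\<close>; the values form a vertex function, which
      \<open>avg\<close> fixes.\<close>
    have "scl (sin (s * l)) (avg (osc_der s a b))
        = transition (osc_val s a b) - scl (cos (s * l)) (osc_val s a b)"
      using arg_cong[OF sin_osc_der[of s a b], of avg]
      by (simp add: avg_scl avg_diff transition_def avg_vertex_funs[OF that])
    then show ?thesis using s(2) by (metis eq_iff_diff_eq_0 fs.scale_eq_0_iff)
  qed
  show "bdvals ` st_eigenspace E L V (s\<^sup>2) = {\<phi>\<in>vertex_funs. transition \<phi> = scl (cos (s * l)) \<phi>}"
  proof
    show "bdvals ` st_eigenspace E L V (s\<^sup>2) \<subseteq> {\<phi>\<in>vertex_funs. transition \<phi> = scl (cos (s * l)) \<phi>}"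
      using st_eigenspace_iff[OF s(1)] key bdvals_osc by auto
    show "{\<phi>\<in>vertex_funs. transition \<phi> = scl (cos (s * l)) \<phi>} \<subseteq> bdvals ` st_eigenspace E L V (s\<^sup>2)"
    proof clarify
      fix \<phi> assume phi: "\<phi> \<in> vertex_funs" "transition \<phi> = scl (cos (s * l)) \<phi>"
      \<comment> \<open>Away from resonance the two end values determine both amplitudes.\<close>
      define a where "a i = \<phi> (i, False)" for i
      define b where "b i = (\<phi> (i, True) - a i * cos (s * l)) / sin (s * l)" for i
      have "osc_val s a b = \<phi>"
      proof
        fix p :: endpoint
        show "osc_val s a b p = \<phi> p"
          using vertex_funsD(1)[OF phi(1), of p] s(2)
          by (cases p; cases "snd p") (auto simp: osc_val_def a_def b_def)
      qed
      then show "\<phi> \<in> bdvals ` st_eigenspace E L V (s\<^sup>2)"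
        using st_eigenspace_iff[OF s(1)] key[of a b] phi bdvals_osc[of s a b] by (metis image_eqI)
    qed
  qed
  show "inj_on bdvals (st_eigenspace E L V (s\<^sup>2))"
  proof (rule inj_onI)
    fix f f' assume "f \<in> st_eigenspace E L V (s\<^sup>2)" "f' \<in> st_eigenspace E L V (s\<^sup>2)" "bdvals f = bdvals f'"
    then show "f = f'" using st_eigenspace_iff[OF s(1)] bdvals_osc osc_val_inj[OF s(2)] by metis
  qed
qed

text \<open>At \<open>sin (s l) = 0\<close> the boundary values no longer determine the function; adding
  the sine amplitude, read off at the point \<open>\<pi> / (2 s)\<close>, restores injectivity.\<close>
definition bdvals_amp :: "real \<Rightarrow> (nat \<Rightarrow> real \<Rightarrow> real) \<Rightarrow> endpoint \<Rightarrow> real" where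
  "bdvals_amp s f p = (if p \<in> X then endval L f p + (if snd p then - cos (s * l) else 1) * f (fst p) (pi / (2 * s)) else 0)"

lemma linear_bdvals_amp: "Vector_Spaces.linear fscale scl (bdvals_amp s)"
  by (rule linear_fscaleI) (auto simp: bdvals_amp_def intro!: ext simp: algebra_simps)

context
  fixes s assumes s: "0 < s" "sin (s * l) = 0"
begin

text \<open>A positive zero of the sine is at least \<open>pi\<close>, so the sampling point lies in
  the first half of the edge.\<close>

lemma half_period_le: "pi / (2 * s) \<in> {0..l}"
proof -
  have "\<not> s * l < pi" using sin_gt_zero[of "s * l"] s l_pos by auto
  then have "pi \<le> 2 * (s * l)" using pi_gt_zero by linarith
  then show ?thesis using s l_pos by (auto simp: field_simps)
qed

lemma cos_sign: "cos (s * l) = 1 \<or> cos (s * l) = -1"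
  using sin_cos_squared_add[of "s * l"] s by (auto simp: power2_eq_1_iff)

text \<open>At the sampling point the cosine is 0 and the sine 1, so \<open>b\<close> is read off;
  the weights 1 and \<open>- cos (s * l)\<close> turn it into \<open>osc_der\<close>.\<close>

lemma bdvals_amp_osc: "bdvals_amp s (osc s a b) = osc_val s a b + osc_der s a b"
proof
  fix p :: endpoint
  have "p \<in> X \<Longrightarrow> osc s a b (fst p) (pi / (2 * s)) = b (fst p)"
    using half_period_le s by (simp add: osc_def in_endpoints_iff)
  moreover have "p \<in> X \<Longrightarrow> endval L (osc s a b) p = osc_val s a b p"
    using fun_cong[OF bdvals_osc[of s a b], of p] by (simp add: bdvals_def)
  ultimately show "bdvals_amp s (osc s a b) p = (osc_val s a b + osc_der s a b) p"
    using s by (auto simp: bdvals_amp_def osc_val_def osc_der_def)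
qed

lemma bdvals_amp_inj: 
  assumes "bdvals_amp s (osc s a b) = bdvals_amp s (osc s a' b')"
  shows "osc s a b = osc s a' b'"
proof -
  \<comment> \<open>The two ends give the sum and, up to a sign, the difference of the
    amplitudes.\<close>
  have *: "a i + b i = a' i + b' i \<and> a i - b i = a' i - b' i" if i: "i < E" for i
  proof -
    have v: "bdvals_amp s (osc s a b) (i, False) = a i + b i" "bdvals_amp s (osc s a b) (i, True) = cos (s * l) * (a i - b i)"
      for a b
      using i s unfolding bdvals_amp_osc by (auto simp: osc_val_def osc_der_def endpoints_def algebra_simps)
    have "cos (s * l) * (a i - b i) = cos (s * l) * (a' i - b' i)" using v(2) assms by metis
    then have "a i - b i = a' i - b' i" using cos_sign by auto
    then show ?thesis using v(1) assms by metis
  qed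
  show ?thesis
  proof (rule osc_cong)
    fix i assume "i < E"
    then show "a i = a' i" "b i = b' i" using *[of i] by linarith+
  qed
qed

lemma osc_val_opp: "osc_val s a b (opp p) = cos (s * l) * osc_val s a b p"
  using s cos_sign by (auto simp: osc_val_def)

lemma osc_der_odd: "osc_der s a b \<in> odd_funs (cos (s * l))"
  using s cos_sign by (intro odd_funsI) (auto simp: osc_der_def)

lemma osc_val_eqI:
  assumes "\<phi> \<in> even_funs (cos (s * l))"
  shows "osc_val s (\<lambda>i. \<phi> (i, False)) b = \<phi>"
proof
  fix p :: endpoint
  show "osc_val s (\<lambda>i. \<phi> (i, False)) b p = \<phi> p"
    using vertex_funsD(1)[OF even_funsD(1)[OF assms], of p] even_funsD(2)[OF assms, of "(fst p, False)"] s
    by (cases p; cases "snd p") (auto simp: osc_val_def)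
qed

lemma osc_der_eqI:
  assumes "\<psi> \<in> odd_funs (cos (s * l))"
  shows "osc_der s a (\<lambda>i. \<psi> (i, False)) = \<psi>"
proof
  fix p :: endpoint
  show "osc_der s a (\<lambda>i. \<psi> (i, False)) p = \<psi> p"
    using odd_funsD(1)[OF assms, of p] odd_funsD(2)[OF assms, of "(fst p, False)"] s
    by (cases p; cases "snd p") (auto simp: osc_der_def)
qed

text \<open>At a resonance the conditions decouple: \<open>osc_val\<close> depends only on
  \<open>a\<close> and \<open>osc_der\<close> only on \<open>b\<close>, so continuity restricts the
  cosine part and Kirchhoff the sine part.\<close>

lemma mult_st_resonant:
  "multiplicity_of (st_eigenspace E L V (s\<^sup>2))
    = fs.dim {\<phi> + \<psi> | \<phi> \<psi>. \<phi> \<in> even_funs (cos (s * l)) \<and> \<psi> \<in> flows (cos (s * l))}"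
proof -
  let ?S = "st_eigenspace E L V (s\<^sup>2)"
  have "inj_on (bdvals_amp s) ?S"
  proof (rule inj_onI)
    fix f f' assume "f \<in> ?S" "f' \<in> ?S" "bdvals_amp s f = bdvals_amp s f'"
    then show "f = f'" using st_eigenspace_iff[OF s(1)] bdvals_amp_inj by metis
  qed
  moreover have "bdvals_amp s ` ?S
    = {\<phi> + \<psi> | \<phi> \<psi>. \<phi> \<in> even_funs (cos (s * l)) \<and> \<psi> \<in> flows (cos (s * l))}" (is "_ = ?R")
  proof
    show "bdvals_amp s ` ?S \<subseteq> ?R"
    proof
      fix \<eta> assume "\<eta> \<in> bdvals_amp s ` ?S"
      then obtain a b where ab: "\<eta> = bdvals_amp s (osc s a b)" "osc_val s a b \<in> vertex_funs" "avg (osc_der s a b) = 0"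
        using st_eigenspace_iff[OF s(1)] by auto
      have "osc_val s a b \<in> even_funs (cos (s * l))" by (intro even_funsI ab osc_val_opp)
      moreover have "osc_der s a b \<in> flows (cos (s * l))" using ab osc_der_odd by (simp add: flows_def)
      ultimately show "\<eta> \<in> ?R" using ab(1) bdvals_amp_osc by blast
    qed
    show "?R \<subseteq> bdvals_amp s ` ?S"
    proof
      fix \<eta> assume "\<eta> \<in> ?R"
      then obtain \<phi> \<psi> where chi: "\<eta> = \<phi> + \<psi>" and phi: "\<phi> \<in> even_funs (cos (s * l))" and psi: "\<psi> \<in> flows (cos (s * l))"
        by blast
      let ?f = "osc s (\<lambda>i. \<phi> (i, False)) (\<lambda>i. \<psi> (i, False))"
      have odd: "\<psi> \<in> odd_funs (cos (s * l))" "avg \<psi> = 0" using psi by (auto simp: flows_def)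
      have "?f \<in> ?S"
        using st_eigenspace_iff[OF s(1), of ?f] osc_val_eqI[OF phi] osc_der_eqI[OF odd(1)] odd(2) even_funsD(1)[OF phi]
        by metis
      moreover have "bdvals_amp s ?f = \<eta>"
        unfolding bdvals_amp_osc osc_val_eqI[OF phi] osc_der_eqI[OF odd(1)] chi ..
      ultimately show "\<eta> \<in> bdvals_amp s ` ?S" by blast
    qed
  qed
  ultimately show ?thesis
    using dim_image_inj[OF linear_bdvals_amp subspace_st_eigenspace] by (simp add: multiplicity_of_def)
qed

text \<open>The Dirichlet condition kills the cosine part and leaves one free sine amplitude on each
  edge.\<close>

lemma mult_D_resonant: "multiplicity_of (D_eigenspace E L (s\<^sup>2)) = E"
proof -
  let ?S = "D_eigenspace E L (s\<^sup>2)"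
  have "inj_on (bdvals_amp s) ?S"
  proof (rule inj_onI)
    fix f f' assume "f \<in> ?S" "f' \<in> ?S" "bdvals_amp s f = bdvals_amp s f'"
    then show "f = f'" using D_eigenspace_iff[OF s(1)] bdvals_amp_inj by metis
  qed
  moreover have "bdvals_amp s ` ?S = odd_funs (cos (s * l))"
  proof
    show "bdvals_amp s ` ?S \<subseteq> odd_funs (cos (s * l))"
    proof
      fix \<eta> assume "\<eta> \<in> bdvals_amp s ` ?S"
      then obtain a b where ab: "\<eta> = bdvals_amp s (osc s a b)" "osc_val s a b = 0"
        using D_eigenspace_iff[OF s(1)] by auto
      then show "\<eta> \<in> odd_funs (cos (s * l))" using osc_der_odd[of a b] bdvals_amp_osc[of a b] by simp
    qed
    show "odd_funs (cos (s * l)) \<subseteq> bdvals_amp s ` ?S"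
    proof
      fix \<psi> assume psi: "\<psi> \<in> odd_funs (cos (s * l))"
      let ?f = "osc s (\<lambda>i. 0) (\<lambda>i. \<psi> (i, False))"
      have z: "osc_val s (\<lambda>i. 0) (\<lambda>i. \<psi> (i, False)) = 0" using s by (intro ext) (simp add: osc_val_def)
      have "?f \<in> ?S" using D_eigenspace_iff[OF s(1), of ?f] z by blast
      moreover have "bdvals_amp s ?f = \<psi>"
        unfolding bdvals_amp_osc z osc_der_eqI[OF psi] by simp
      ultimately show "\<psi> \<in> bdvals_amp s ` ?S" by (metis image_eqI)
    qed
  qed
  ultimately show ?thesis
    using dim_image_inj[OF linear_bdvals_amp subspace_D_eigenspace] dim_odd_funs[OF cos_sign]
    by (simp add: multiplicity_of_def)
qed

end

end

section \<open>Counting eigenvalues\<close>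

context
  fixes m :: "real \<Rightarrow> nat"
  assumes fin: "\<And>t. finite {\<mu>. \<mu> \<le> t \<and> 0 < m \<mu>}"
begin

lemma eig_count_le_of_subset:
  assumes "{\<mu>. \<mu> \<le> s \<and> 0 < m \<mu>} \<subseteq> {\<mu>. \<mu> \<le> t \<and> 0 < m \<mu>}"
  shows "eig_count m s \<le> eig_count m t"
  unfolding eig_count_def by (rule sum_mono2[OF fin assms]) simp

text \<open>By finiteness the counting function stays constant for a while to the right of every
  point, hence the infimum defining \<open>nth_eig\<close> is attained. The level \<open>t0\<close>
  makes its set nonempty, and \<open>nonneg\<close> bounds it below.\<close>

lemma nth_eig_le_iff:
  assumes nonneg: "\<And>\<mu>. \<mu> < 0 \<Longrightarrow> m \<mu> = 0" and n: "1 \<le> n" and t0: "n \<le> eig_count m t0"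
  shows "nth_eig m n \<le> t \<longleftrightarrow> n \<le> eig_count m t"
proof
  assume "n \<le> eig_count m t"
  moreover have "0 \<le> x" if "n \<le> eig_count m x" for x
  proof (rule ccontr)
    assume "\<not> 0 \<le> x"
    then have "{\<mu>. \<mu> \<le> x \<and> 0 < m \<mu>} = {}" using nonneg by force
    then have "eig_count m x = 0" unfolding eig_count_def by simp
    then show False using that n by simp
  qed
  then have "bdd_below {t. n \<le> eig_count m t}" by (intro bdd_belowI[of _ 0]) auto
  ultimately show "nth_eig m n \<le> t" unfolding nth_eig_def by (intro cInf_lower) auto
next
  assume le: "nth_eig m n \<le> t"
  show "n \<le> eig_count m t"
  proof (rule ccontr)
    assume "\<not> n \<le> eig_count m t"
    \<comment> \<open>The eigenvalues just above \<open>t\<close>, capped by \<open>t + 1\<close> so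
      that a minimum exists; below \<open>Min F\<close> the count does not exceed that at
      \<open>t\<close>.\<close>
    define F where "F = insert (t + 1) {\<mu>. \<mu> \<le> t + 1 \<and> 0 < m \<mu> \<and> t < \<mu>}"
    have "finite {\<mu>. \<mu> \<le> t + 1 \<and> 0 < m \<mu> \<and> t < \<mu>}"
      by (rule finite_subset[OF _ fin[of "t + 1"]]) auto
    then have F: "finite F" unfolding F_def by simp
    have "t < Min F" using F by (subst Min_gr_iff) (auto simp: F_def)
    moreover have "Min F \<le> x" if x: "n \<le> eig_count m x" for x
    proof (rule ccontr)
      assume "\<not> Min F \<le> x"
      then have lt: "x < y" if "y \<in> F" for y using Min_le[OF F that] by linarith
      have "{\<mu>. \<mu> \<le> x \<and> 0 < m \<mu>} \<subseteq> {\<mu>. \<mu> \<le> t \<and> 0 < m \<mu>}"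
      proof clarify
        fix \<mu> assume mu: "\<mu> \<le> x" "0 < m \<mu>"
        have "\<mu> \<le> t + 1" using lt[of "t + 1"] mu by (simp add: F_def)
        then show "\<mu> \<le> t" using lt[of \<mu>] mu by (force simp: F_def)
      qed
      then have "eig_count m x \<le> eig_count m t" by (rule eig_count_le_of_subset)
      with x \<open>\<not> n \<le> eig_count m t\<close> show False by simp
    qed
    then have "Min F \<le> nth_eig m n" unfolding nth_eig_def using t0 by (intro cInf_greatest) auto
    ultimately show False using le by simp
  qed
qed

end

section \<open>Dirichlet eigenvalues and their count\<close>

context equilateral_graph
begin

text \<open>Level 0 is no Dirichlet eigenvalue but the lower end of the first block, where the
  standard eigenvalue 0 sits.\<close>

definition D_level :: "nat \<Rightarrow> real" where
  "D_level k = (k * pi / l)\<^sup>2"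

lemma strict_mono_D_level: "strict_mono D_level"
proof (rule strict_monoI)
  fix j k :: nat assume "j < k"
  then show "D_level j < D_level k"
    unfolding D_level_def using l_pos by (intro power_strict_mono) (auto simp: field_simps)
qed

lemma D_level_unbounded: "\<exists>k. t \<le> D_level k"
proof -
  define M where "M = max 1 \<bar>t\<bar>"
  have M: "1 \<le> M" "\<bar>t\<bar> \<le> M" by (auto simp: M_def)
  obtain k :: nat where k: "M * l / pi \<le> k" using real_arch_simple by blast
  then have "M \<le> k * pi / l" using l_pos pi_gt_zero by (simp add: field_simps)
  then have "M\<^sup>2 \<le> D_level k"
    unfolding D_level_def using M by (intro power_mono) auto
  moreover have "M \<le> M\<^sup>2" using M mult_left_mono[of 1 M M] by (simp add: power2_eq_square)
  ultimately have "\<bar>t\<bar> \<le> D_level k" using M by linarith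
  then show ?thesis by (intro exI[of _ k]) linarith
qed

abbreviation mult_st :: "real \<Rightarrow> nat" where
  "mult_st lam \<equiv> multiplicity_of (st_eigenspace E L V lam)"

abbreviation mult_D :: "real \<Rightarrow> nat" where
  "mult_D lam \<equiv> multiplicity_of (D_eigenspace E L lam)"

lemma mult_D_eq: "mult_D lam = (if \<exists>k. lam = D_level (Suc k) then E else 0)"
proof (cases "\<exists>k. lam = D_level (Suc k)")
  case True
  then obtain k where k: "lam = D_level (Suc k)" by blast
  have "sin (Suc k * pi / l * l) = 0" using l_pos sin_npi[of "Suc k"] by simp
  moreover have "0 < Suc k * pi / l" using l_pos by simp
  ultimately show ?thesis using True mult_D_resonant k by (simp add: D_level_def)
next
  case False
  have "mult_D lam = 0"
  proof (cases "0 < lam")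
    case True
    define s where "s = sqrt lam"
    have s: "0 < s" "lam = s\<^sup>2" using True by (auto simp: s_def)
    have "sin (s * l) \<noteq> 0"
    proof
      assume "sin (s * l) = 0"
      then obtain i where i: "s * l = of_int i * pi" by (auto simp: sin_zero_iff_int2)
      have "0 < s * l" using s l_pos by simp
      then have "0 < i" using i pi_gt_zero by (simp add: zero_less_mult_iff)
      then have "s * l = real (Suc (nat i - 1)) * pi" using i by simp
      then have "s = real (Suc (nat i - 1)) * pi / l" using l_pos by (simp only: nonzero_eq_divide_eq[of l])
      then have "lam = D_level (Suc (nat i - 1))" unfolding s(2) D_level_def by simp
      then show False using False by blast
    qed
    then show ?thesis using mult_D_generic s by simp
  next
    case False
    then show ?thesis using mult_D_nonpositive by simp
  qed
  then show ?thesis using False by simp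
qed

lemma D_eigenvalues_le: 
  assumes "t < D_level (Suc k)"
  shows "{\<mu>. \<mu> \<le> t \<and> 0 < mult_D \<mu>} \<subseteq> D_level ` {1..k}"
proof clarify
  fix \<mu> assume mu: "\<mu> \<le> t" "0 < mult_D \<mu>"
  then obtain j where j: "\<mu> = D_level (Suc j)" using mult_D_eq[of \<mu>] by (auto split: if_splits)
  then have "Suc j < Suc k" using mu assms strict_mono_less[OF strict_mono_D_level] by (metis order_le_less_trans)
  then show "\<mu> \<in> D_level ` {1..k}" using j by auto
qed

lemma D_finite: "finite {\<mu>. \<mu> \<le> t \<and> 0 < mult_D \<mu>}"
proof -
  obtain k where "t \<le> D_level k" using D_level_unbounded by blast
  then have "t < D_level (Suc k)" using strict_mono_less[OF strict_mono_D_level, of k "Suc k"] by simp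
  then show ?thesis using D_eigenvalues_le finite_subset by blast
qed

lemma D_count: "eig_count mult_D (D_level k) = k * E"
proof -
  have "{\<mu>. \<mu> \<le> D_level k \<and> 0 < mult_D \<mu>} = D_level ` {1..k}"
  proof
    show "{\<mu>. \<mu> \<le> D_level k \<and> 0 < mult_D \<mu>} \<subseteq> D_level ` {1..k}"
      by (rule D_eigenvalues_le) (simp add: strict_mono_less[OF strict_mono_D_level])
    show "D_level ` {1..k} \<subseteq> {\<mu>. \<mu> \<le> D_level k \<and> 0 < mult_D \<mu>}"
    proof clarify
      fix j assume j: "j \<in> {1..k}"
      then have "j = Suc (j - 1)" by simp
      then have "mult_D (D_level j) = E" using mult_D_eq by metis
      then show "D_level j \<le> D_level k \<and> 0 < mult_D (D_level j)"
        using j E_pos strict_mono_less_eq[OF strict_mono_D_level] by simp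
    qed
  qed
  moreover have "mult_D (D_level j) = E" if "j \<in> {1..k}" for j
  proof -
    have "j = Suc (j - 1)" using that by simp
    then show ?thesis using mult_D_eq by metis
  qed
  moreover have "inj_on D_level {1..k}" using strict_mono_D_level strict_mono_imp_inj_on inj_on_subset by blast
  ultimately show ?thesis unfolding eig_count_def by (simp add: sum.reindex)
qed

text \<open>The count jumps from \<open>k * E\<close> to \<open>Suc k * E\<close> at this level and
  is constant between consecutive levels.\<close>

lemma lambda_D_eq:
  assumes "k * E < n" "n \<le> Suc k * E"
  shows "lambda_D E L n = D_level (Suc k)"
proof -
  have iff: "nth_eig mult_D n \<le> t \<longleftrightarrow> n \<le> eig_count mult_D t" for t
    using assms D_count[of "Suc k"]
    by (intro nth_eig_le_iff[OF D_finite, of n "D_level (Suc k)"]) (auto intro: mult_D_nonpositive)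
  have "nth_eig mult_D n \<le> D_level (Suc k)" using iff D_count[of "Suc k"] assms by simp
  moreover have "\<not> nth_eig mult_D n < D_level (Suc k)"
  proof
    let ?t = "nth_eig mult_D n"
    assume "?t < D_level (Suc k)"
    then have "{\<mu>. \<mu> \<le> ?t \<and> 0 < mult_D \<mu>} \<subseteq> {\<mu>. \<mu> \<le> D_level k \<and> 0 < mult_D \<mu>}"
      using D_eigenvalues_le[of ?t k] strict_mono_less_eq[OF strict_mono_D_level] by auto
    then have "eig_count mult_D ?t \<le> k * E"
      using eig_count_le_of_subset[OF D_finite, of ?t "D_level k"] D_count[of k] by simp
    moreover have "n \<le> eig_count mult_D ?t" using iff[of ?t] by simp
    ultimately show False using assms by simp
  qed
  ultimately show ?thesis unfolding lambda_D_def by simp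
qed

end

section \<open>Standard eigenvalues, counted block by block\<close>

context equilateral_graph_eigenbasis
begin

definition inner_basis :: "(endpoint \<Rightarrow> real) set" where
  "inner_basis = {b\<in>B. \<bar>\<mu> b\<bar> < 1}"

text \<open>Solves \<open>cos (s * l) = \<mu> b\<close> in the k-th interval: the sign compensates
  \<open>cos (k * pi + x) = (-1) ^ k * cos x\<close>, and \<open>arccos\<close> supplies
  \<open>x\<close>.\<close>

definition st_freq :: "nat \<Rightarrow> (endpoint \<Rightarrow> real) \<Rightarrow> real" where
  "st_freq k b = (k * pi + arccos ((-1) ^ k * \<mu> b)) / l"

lemma cos_add_npi: "cos (real k * pi + x) = (-1) ^ k * cos x"
  by (simp add: cos_add)

lemma st_freq:
  assumes "b \<in> inner_basis"
  shows "cos (st_freq k b * l) = \<mu> b" "k * pi / l < st_freq k b" "st_freq k b < Suc k * pi / l"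
proof -
  have m: "-1 < (-1) ^ k * \<mu> b" "(-1) ^ k * \<mu> b < 1"
    using assms by (cases "even k"; auto simp: inner_basis_def)+
  then have a: "0 < arccos ((-1) ^ k * \<mu> b)" "arccos ((-1) ^ k * \<mu> b) < pi"
    using arccos_lt_bounded by auto
  have "st_freq k b * l = k * pi + arccos ((-1) ^ k * \<mu> b)" using l_pos by (simp add: st_freq_def)
  then show "cos (st_freq k b * l) = \<mu> b"
    using m by (simp add: cos_add_npi cos_arccos flip: mult.assoc power_mult_distrib)
  show "k * pi / l < st_freq k b" "st_freq k b < Suc k * pi / l"
    unfolding st_freq_def using a l_pos by (auto simp: field_simps)
qed

lemma st_freq_unique:
  assumes "k * pi / l < s" "s < Suc k * pi / l" "\<mu> b = cos (s * l)"
  shows "st_freq k b = s"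
proof -
  define x where "x = s * l - k * pi"
  have x: "0 < x" "x < pi" using assms l_pos by (auto simp: x_def field_simps)
  have "\<mu> b = (-1) ^ k * cos x"
    using assms(3) cos_add_npi[of k x] by (simp add: x_def)
  then have "(-1) ^ k * \<mu> b = cos x" by (simp flip: mult.assoc power_mult_distrib)
  then show ?thesis using x l_pos by (simp add: st_freq_def arccos_cos) (simp add: x_def)
qed

lemma sin_between_nonzero:
  assumes "k * pi / l < s" "s < Suc k * pi / l"
  shows "sin (s * l) \<noteq> 0"
proof -
  define x where "x = s * l - k * pi"
  have x: "0 < x" "x < pi" using assms l_pos by (auto simp: x_def field_simps)
  have "sin (s * l) = sin (real k * pi + x)" by (simp add: x_def)
  also have "\<dots> = (-1) ^ k * sin x" by (simp add: sin_add)
  finally show ?thesis using sin_gt_zero[OF x] by simp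
qed

lemma mult_st_generic:
  assumes s: "0 < s" "sin (s * l) \<noteq> 0"
  shows "mult_st (s\<^sup>2) = card {b\<in>B. \<mu> b = cos (s * l)}"
  using dim_image_inj[OF linear_bdvals subspace_st_eigenspace bdvals_st_eigenspace(2)[OF s]]
  by (simp add: multiplicity_of_def bdvals_st_eigenspace(1)[OF s] dim_transition_eigenspace)

lemma mult_st_between:
  assumes s: "k * pi / l < s" "s < Suc k * pi / l"
  shows "mult_st (s\<^sup>2) = card {b\<in>inner_basis. (st_freq k b)\<^sup>2 = s\<^sup>2}"
proof -
  have "0 \<le> k * pi / l" using l_pos by simp
  then have s0: "0 < s" using s by linarith
  have sin0: "sin (s * l) \<noteq> 0" by (rule sin_between_nonzero[OF s])
  have "\<mu> b = cos (s * l) \<longleftrightarrow> \<bar>\<mu> b\<bar> < 1 \<and> (st_freq k b)\<^sup>2 = s\<^sup>2" if b: "b \<in> B" for b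
  proof
    assume m: "\<mu> b = cos (s * l)"
    have "(cos (s * l))\<^sup>2 < 1" using sin_cos_squared_add[of "s * l"] sin0 by (smt (verit) zero_less_power2)
    then have "\<bar>\<mu> b\<bar> < 1" using m by (simp add: abs_square_less_1)
    then show "\<bar>\<mu> b\<bar> < 1 \<and> (st_freq k b)\<^sup>2 = s\<^sup>2" using st_freq_unique[OF s m] by simp
  next
    assume a: "\<bar>\<mu> b\<bar> < 1 \<and> (st_freq k b)\<^sup>2 = s\<^sup>2"
    then have ib: "b \<in> inner_basis" using b by (simp add: inner_basis_def)
    have "0 < st_freq k b" using st_freq(2)[OF ib, of k] \<open>0 \<le> k * pi / l\<close> by linarith
    \<comment> \<open>Both frequencies are positive, so equal squares mean equal
      frequencies.\<close>
    then have "st_freq k b = s" using a s0 by (simp add: power2_eq_iff)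
    then show "\<mu> b = cos (s * l)" using st_freq(1)[OF ib, of k] by simp
  qed
  then have "{b\<in>B. \<mu> b = cos (s * l)} = {b\<in>inner_basis. (st_freq k b)\<^sup>2 = s\<^sup>2}"
    unfolding inner_basis_def by blast
  then show ?thesis using mult_st_generic[OF s0 sin0] by simp
qed

lemma finite_inner: "finite inner_basis"
  using finB by (simp add: inner_basis_def)

lemma st_block:
  shows "{lam. D_level k < lam \<and> lam < D_level (Suc k) \<and> 0 < mult_st lam} = (\<lambda>b. (st_freq k b)\<^sup>2) ` inner_basis"
    (is "?S = ?I")
  and "(\<Sum>lam | D_level k < lam \<and> lam < D_level (Suc k) \<and> 0 < mult_st lam. mult_st lam) = card inner_basis"
proof -
  have nn: "0 \<le> k * pi / l" using l_pos by simp
  have sq: "\<exists>s. lam = s\<^sup>2 \<and> k * pi / l < s \<and> s < Suc k * pi / l"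
    if lam: "D_level k < lam" "lam < D_level (Suc k)" for lam
  proof (intro exI[of _ "sqrt lam"] conjI)
    have "0 \<le> D_level k" by (simp add: D_level_def)
    then show "lam = (sqrt lam)\<^sup>2" using lam by simp
    show "k * pi / l < sqrt lam" using lam(1) nn unfolding D_level_def by (rule_tac real_less_rsqrt)
    show "sqrt lam < Suc k * pi / l"
      using lam(2) l_pos unfolding D_level_def by (intro real_less_lsqrt) auto
  qed
  have range: "D_level k < (st_freq k b)\<^sup>2" "(st_freq k b)\<^sup>2 < D_level (Suc k)" if "b \<in> inner_basis" for b
    using st_freq(2,3)[OF that, of k] nn unfolding D_level_def by (auto intro!: power_strict_mono)
  have mult: "mult_st lam = card {b\<in>inner_basis. (st_freq k b)\<^sup>2 = lam}"
    if lam: "D_level k < lam" "lam < D_level (Suc k)" for lam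
    using sq[OF lam] mult_st_between by blast
  show eq: "?S = ?I"
  proof (intro set_eqI iffI)
    fix lam assume "lam \<in> ?S"
    then have "0 < card {b\<in>inner_basis. (st_freq k b)\<^sup>2 = lam}" using mult[of lam] by simp
    then have "{b\<in>inner_basis. (st_freq k b)\<^sup>2 = lam} \<noteq> {}" by (metis card.empty less_irrefl)
    then show "lam \<in> ?I" by blast
  next
    fix lam assume "lam \<in> ?I"
    then obtain b where b: "b \<in> inner_basis" "lam = (st_freq k b)\<^sup>2" by blast
    then have "0 < card {b\<in>inner_basis. (st_freq k b)\<^sup>2 = lam}"
      using finite_inner by (auto simp: card_gt_0_iff)
    then show "lam \<in> ?S" using range[OF b(1)] mult[of lam] b(2) by simp
  qed
  \<comment> \<open>Several basis vectors may share an eigenvalue; summing the sizes of the fibres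
    counts each vector once.\<close>
  have "(\<Sum>lam\<in>?S. mult_st lam) = (\<Sum>lam\<in>?I. card {b\<in>inner_basis. (st_freq k b)\<^sup>2 = lam})"
    unfolding eq using range mult by (intro sum.cong refl) auto
  also have "\<dots> = card inner_basis"
    using sum.image_gen[OF finite_inner, of "\<lambda>_. 1 :: nat" "\<lambda>b. (st_freq k b)\<^sup>2"] by simp
  finally show "(\<Sum>lam\<in>?S. mult_st lam) = card inner_basis" .
qed

lemma mult_st_level:
  "mult_st (D_level (Suc k)) + card inner_basis + fs.dim (even_funs (- ((-1) ^ Suc k)))
    = E + fs.dim (even_funs ((-1) ^ Suc k))"
proof -
  define s where "s = Suc k * pi / l"
  have s: "0 < s" "s * l = Suc k * pi" using l_pos by (auto simp: s_def)
  have c: "cos (s * l) = (-1) ^ Suc k" unfolding s(2) by (rule cos_npi)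
  have z: "sin (s * l) = 0" unfolding s(2) by (rule sin_npi)
  have "D_level (Suc k) = s\<^sup>2" by (simp add: D_level_def s_def)
  then show ?thesis
    using mult_st_resonant[OF s(1) z] dim_even_plus_flows[OF cos_sign[OF s(1) z]]
    unfolding c inner_basis_def by simp
qed

text \<open>The excess over \<open>k * E\<close> starts at 1 with the eigenvalue 0. It persists in a
  bipartite graph; otherwise it is lost at odd and regained at even levels. Finiteness is carried
  along so that the sums can be split.\<close>

lemma st_count_aux:
  "finite {lam. lam \<le> D_level k \<and> 0 < mult_st lam} \<and>
   eig_count mult_st (D_level k) = k * E + (if even k \<or> bipartite E V then 1 else 0)"
proof (induction k)
  case 0
  have "{lam. lam \<le> D_level 0 \<and> 0 < mult_st lam} = {0}"
  proof (intro equalityI subsetI)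
    fix lam assume "lam \<in> {lam. lam \<le> D_level 0 \<and> 0 < mult_st lam}"
    then show "lam \<in> {0}" using mult_st_negative[of lam] by (cases "lam < 0") (auto simp: D_level_def)
  qed (simp add: D_level_def mult_st_0)
  then show ?case by (simp add: eig_count_def mult_st_0)
next
  case (Suc k)
  let ?C = "\<lambda>k. {lam. lam \<le> D_level k \<and> 0 < mult_st lam}"
  let ?M = "{lam. D_level k < lam \<and> lam < D_level (Suc k) \<and> 0 < mult_st lam}"
  let ?T = "{lam. lam = D_level (Suc k) \<and> 0 < mult_st lam}"
  have lt: "D_level k < D_level (Suc k)" by (simp add: strict_mono_less[OF strict_mono_D_level])
  have C: "?C (Suc k) = (?C k \<union> ?M) \<union> ?T" using lt by auto
  have finM: "finite ?M" unfolding st_block(1) using finite_inner by simp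
  have finT: "finite ?T" by simp
  have fin: "finite (?C (Suc k))" unfolding C using Suc.IH finM finT by blast
  have "eig_count mult_st (D_level (Suc k)) = sum mult_st (?C k \<union> ?M) + sum mult_st ?T"
    unfolding eig_count_def C using Suc.IH finM lt by (intro sum.union_disjoint) auto
  also have "sum mult_st (?C k \<union> ?M) = sum mult_st (?C k) + sum mult_st ?M"
    using Suc.IH finM by (intro sum.union_disjoint) auto
  also have "sum mult_st ?M = card inner_basis" by (rule st_block(2))
  also have "sum mult_st ?T = mult_st (D_level (Suc k))"
  proof (cases "0 < mult_st (D_level (Suc k))")
    case True
    then have "?T = {D_level (Suc k)}" by auto
    then show ?thesis by simp
  next
    case False
    then have "?T = {}" by auto
    then show ?thesis using False by simp
  qed
  finally have "eig_count mult_st (D_level (Suc k))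
      = eig_count mult_st (D_level k) + card inner_basis + mult_st (D_level (Suc k))"
    by (simp add: eig_count_def)
  then have "eig_count mult_st (D_level (Suc k))
      = k * E + (if even k \<or> bipartite E V then 1 else 0) + card inner_basis + mult_st (D_level (Suc k))"
    using Suc.IH by simp
  \<comment> \<open>\<open>card inner_basis\<close> cancels against \<open>mult_st_level\<close>;
    the parity of \<open>k\<close> decides which sign \<open>e\<close> has.\<close>
  then have "eig_count mult_st (D_level (Suc k)) = Suc k * E + (if even (Suc k) \<or> bipartite E V then 1 else 0)"
    using mult_st_level[of k] dim_even_funs_1 dim_even_funs_minus_1
    by (cases "even k"; cases "bipartite E V") simp_all
  with fin show ?case by blast
qed

lemma st_finite: "finite {lam. lam \<le> t \<and> 0 < mult_st lam}"
proof -
  obtain k where "t \<le> D_level k" using D_level_unbounded by blast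
  then have "{lam. lam \<le> t \<and> 0 < mult_st lam} \<subseteq> {lam. lam \<le> D_level k \<and> 0 < mult_st lam}" by auto
  then show ?thesis using st_count_aux[of k] finite_subset by blast
qed

text \<open>The Dirichlet eigenvalue is \<open>D_level (Suc k)\<close>, so the question is whether
  \<open>n + 1\<close> standard eigenvalues lie at or below it. There are \<open>Suc k * E\<close>
  of them or one more, so only the last index of a block can fail.\<close>

lemma lambda_st_le_lambda_D_iff:
  assumes n: "k * E < n" "n \<le> Suc k * E"
  shows "lambda_st E L V (n + 1) \<le> lambda_D E L n \<longleftrightarrow> odd k \<or> bipartite E V \<or> n \<noteq> Suc k * E"
proof -
  \<comment> \<open>One level higher there are certainly \<open>n + 1\<close> eigenvalues, so the
    set defining \<open>nth_eig\<close> is nonempty.\<close>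
  have "n + 1 \<le> eig_count mult_st (D_level (Suc (Suc k)))"
    using st_count_aux[of "Suc (Suc k)"] n E_pos by simp
  then have "nth_eig mult_st (n + 1) \<le> D_level (Suc k) \<longleftrightarrow> n + 1 \<le> eig_count mult_st (D_level (Suc k))"
    by (intro nth_eig_le_iff[OF st_finite]) (auto intro: mult_st_negative)
  then show ?thesis
    using st_count_aux[of "Suc k"] n by (auto simp: lambda_D_eq[OF n] lambda_st_def)
qed

lemma lambda_st_le_lambda_D_iff_index:
  assumes n: "1 \<le> n"
  shows "lambda_st E L V (n + 1) \<le> lambda_D E L n \<longleftrightarrow>
    bipartite E V \<or> \<not> (\<exists>m. n = (2 * m + 1) * E)"
proof -
  \<comment> \<open>Blocks of indices are open on the left and closed on the right, hence the shift
    by one.\<close>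
  define k where "k = (n - 1) div E"
  have "k * E \<le> n - 1" by (simp add: k_def)
  moreover have "n - 1 < Suc k * E" using dividend_less_div_times[OF E_pos, of "n - 1"] by (simp add: k_def)
  ultimately have k: "k * E < n" "n \<le> Suc k * E" using n by linarith+
  have "(\<exists>m. n = (2 * m + 1) * E) \<longleftrightarrow> even k \<and> n = Suc k * E"
  proof
    assume "\<exists>m. n = (2 * m + 1) * E"
    then obtain m where m: "n = (2 * m + 1) * E" by blast
    have "k < 2 * m + 1" using k(1) unfolding m by (metis mult_less_cancel2)
    moreover have "2 * m + 1 \<le> Suc k" using k(2) E_pos unfolding m by (metis mult_le_cancel2)
    ultimately have "k = 2 * m" by simp
    then show "even k \<and> n = Suc k * E" using m by simp
  next
    assume a: "even k \<and> n = Suc k * E"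
    then obtain m where "k = 2 * m" by blast
    then show "\<exists>m. n = (2 * m + 1) * E" using a by (intro exI[of _ m]) simp
  qed
  then show ?thesis using lambda_st_le_lambda_D_iff[OF k] by blast
qed

end

theorem mainTheorem12:
  fixes E :: nat and L :: "nat \<Rightarrow> real" and V :: "endpoint set set"
  assumes "0 < E"
    and "metric_graph E L V"
    and "equilateral E L"
    and "graph_connected E V"
  shows "((\<forall>n\<ge>1. lambda_st E L V (n + 1) \<le> lambda_D E L n) \<longleftrightarrow> bipartite E V)
    \<and> (\<not> bipartite E V \<longrightarrow>
         (\<forall>n\<ge>1. lambda_st E L V (n + 1) \<le> lambda_D E L n \<longleftrightarrow>
                   \<not> (\<exists>m::nat. n = (2 * m + 1) * E)))"
proof -
  have "0 < L 0" "partition_on (endpoints E) V"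
    using assms(1,2) unfolding metric_graph_def by blast+
  moreover have "L i = L 0" if "i < E" for i
    using assms(1,3) that unfolding equilateral_def by blast
  ultimately interpret equilateral_graph E L V "L 0"
    using assms by unfold_locales
  obtain B \<mu> where B: "onb X vertex_funs B" "\<And>b. b \<in> B \<Longrightarrow> transition b = scl (\<mu> b) b"
    using eigenbasis by blast
  interpret equilateral_graph_eigenbasis E L V "L 0" B \<mu>
    by unfold_locales (use B in auto)
  \<comment> \<open>The exceptional set contains \<open>n = E\<close>, so in a non-bipartite graph
    the inequality cannot hold for all \<open>n\<close>.\<close>
  have "\<exists>n\<ge>1. \<exists>m. n = (2 * m + 1) * E"
    using \<open>0 < E\<close> by (intro exI[of _ E] conjI exI[of _ 0]) auto
  then show ?thesis using lambda_st_le_lambda_D_iff_index by blast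
qed

end
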